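(* For $\mathfrak L$ a locally SCG category, the following are equivalent: (i) $\mathfrak L$ is a relatively exact $\mathrm{Gpd}^\ast$-category; (ii) $\mathfrak L$ is weakly Puppe 2-exact, every faithful morphism is a 2-kernel and every cofaithful morphism is a 2-cokernel.
   Context: Whiskering is written by juxtaposition. Symmetric categorical group (SCG): a symmetric monoidal groupoid in which every object has an inverse up to isomorphism for the tensor product. Locally SCG category (Nakaoka, without the extra axiom (LS3+)): a strict 2-category $\mathfrak L$ such that (a) every hom-category $\mathfrak L(A,B)$ is equipped with the structure of a symmetric categorical group, with unit object denoted $0=0_{A,B}$ (in particular all 2-cells are invertible); (b) for every morphism $f$ the functors $f\circ-$ and $-\circ f$ between hom-categories are symmetric monoidal, and strictly preserve units: $f\circ 0=0$, $0\circ f=0$, the unit constraints are identities, and whiskering any 2-cell with a zero morphism gives the identity $1_0$; (c) there is a zero object $0$: for every $f\colon 0\to A$ there is a unique 2-cell $f\Rightarrow 0_{0,A}$ and for every $f\colon A\to 0$ there is a unique 2-cell $f\Rightarrow 0_{A,0}$; (d) any two objects have a product and a coproduct (in the bicategorical sense). In this setting the null morphisms are the zero morphisms $0_{A,B}$ and the null 2-cells are the identities $1_0$ of zero morphisms (the 2-ideal $(0)$). 2-kernels: a 2-kernel of $f\colon A\to B$ is $k\colon K\to A$ with a 2-cell $\alpha\colon fk\Rightarrow 0$ such that (1) for every $z\colon Z\to A$ and $\beta\colon fz\Rightarrow 0$ there are $u\colon Z\to K$ and $\gamma\colon z\Rightarrow ku$ with $\beta=(\alpha u)\circ(f\gamma)$;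 (2) for all $u,v\colon Z\to K$ and $\lambda\colon ku\Rightarrow kv$ with $(\alpha v)\circ(f\lambda)=\alpha u$ there is a unique $\mu\colon u\Rightarrow v$ with $k\mu=\lambda$. 2-cokernels are dual. A morphism $f$ is faithful if $f\circ-$ is faithful on all hom-categories, cofaithful if $-\circ f$ is faithful on all hom-categories. "$m$ is a 2-kernel of its 2-cokernel (with appropriate structure 2-cell)" means: if $c$ with $\beta\colon cm\Rightarrow 0$ is a 2-cokernel of $m$, then $m$ with $\beta$ is a 2-kernel of $c$; dually for 2-cokernels. Relatively exact $\mathrm{Gpd}^\ast$-category (Nakaoka): a locally SCG category such that all 2-kernels and 2-cokernels exist, every faithful morphism is a 2-kernel of its 2-cokernel, and every cofaithful morphism is a 2-cokernel of its 2-kernel (with appropriate structure 2-cells). Weakly Puppe 2-exact: all 2-kernels and 2-cokernels exist; the 2-ideal $(0)$ is weakly closed, i.e. for every 2-kernel $(k,\alpha)$ of $f$: for all $s$ and $\delta\colon ks\Rightarrow0$ with $f\delta=\alpha s$ there is $\psi\colon s\Rightarrow 0$ with $k\psi=\delta$, and every 2-cell $\mu\colon0\Rightarrow0$ with $k\mu=1_0$ equals $1_0$, together with the dual conditions for 2-cokernels (this is automatic for $(0)$); every 2-kernel is a 2-kernel of its 2-cokernel and every 2-cokernel is a 2-cokernel of its 2-kernel (with appropriate structure 2-cells); every morphism is isomorphic, via an invertible 2-cell, to a composite of a 2-cokernel followed by a 2-kernel. *)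

theory Defs
  imports Main
begin

section \<open>Categories, symmetric categorical groups, symmetric monoidal functors\<close>

record ('a, 'f) cat =
  obj :: "'a set"
  arr :: "'a \<Rightarrow> 'a \<Rightarrow> 'f set"
  idn :: "'a \<Rightarrow> 'f"
  cmp :: "'f \<Rightarrow> 'f \<Rightarrow> 'f"  (infixr "\<cdot>\<index>" 55)

locale category =
  fixes C :: "('a, 'f, 'x) cat_scheme" (structure)
  assumes idn_arr: "x \<in> obj C \<Longrightarrow> idn C x \<in> arr C x x"
    and cmp_arr: "\<lbrakk>x \<in> obj C; y \<in> obj C; z \<in> obj C; f \<in> arr C x y; g \<in> arr C y z\<rbrakk>
      \<Longrightarrow> g \<cdot> f \<in> arr C x z"
    and cmp_idn: "\<lbrakk>x \<in> obj C; y \<in> obj C; f \<in> arr C x y\<rbrakk> \<Longrightarrow> f \<cdot> idn C x = f"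
    and idn_cmp: "\<lbrakk>x \<in> obj C; y \<in> obj C; f \<in> arr C x y\<rbrakk> \<Longrightarrow> idn C y \<cdot> f = f"
    and cmp_assoc: "\<lbrakk>x \<in> obj C; y \<in> obj C; z \<in> obj C; w \<in> obj C;
        f \<in> arr C x y; g \<in> arr C y z; h \<in> arr C z w\<rbrakk>
      \<Longrightarrow> (h \<cdot> g) \<cdot> f = h \<cdot> (g \<cdot> f)"

definition iso_arr :: "('a, 'f, 'x) cat_scheme \<Rightarrow> 'a \<Rightarrow> 'a \<Rightarrow> 'f set" where
  "iso_arr C x y = {f \<in> arr C x y. \<exists>g \<in> arr C y x.
     g \<cdot>\<^bsub>C\<^esub> f = idn C x \<and> f \<cdot>\<^bsub>C\<^esub> g = idn C y}"

definition isomorphic :: "('a, 'f, 'x) cat_scheme \<Rightarrow> 'a \<Rightarrow> 'a \<Rightarrow> bool" where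
  "isomorphic C x y \<longleftrightarrow> iso_arr C x y \<noteq> {}"

locale groupoid = category +
  assumes all_iso: "\<lbrakk>x \<in> obj C; y \<in> obj C\<rbrakk> \<Longrightarrow> arr C x y = iso_arr C x y"

record ('a, 'f) smcat = "('a, 'f) cat" +
  tens :: "'a \<Rightarrow> 'a \<Rightarrow> 'a"  (infixr "\<otimes>\<index>" 70)
  atens :: "'f \<Rightarrow> 'f \<Rightarrow> 'f"  (infixr "\<boxtimes>\<index>" 70)
  unt :: "'a"  ("\<I>\<index>")
  asc :: "'a \<Rightarrow> 'a \<Rightarrow> 'a \<Rightarrow> 'f"
  lun :: "'a \<Rightarrow> 'f"
  run :: "'a \<Rightarrow> 'f"
  sym :: "'a \<Rightarrow> 'a \<Rightarrow> 'f"

locale symmetric_monoidal_category = category C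
  for C :: "('a, 'f, 'x) smcat_scheme" (structure) +
  assumes tens_obj: "\<lbrakk>x \<in> obj C; y \<in> obj C\<rbrakk> \<Longrightarrow> x \<otimes> y \<in> obj C"
    and atens_arr: "\<lbrakk>x \<in> obj C; x' \<in> obj C; y \<in> obj C; y' \<in> obj C;
        f \<in> arr C x x'; g \<in> arr C y y'\<rbrakk> \<Longrightarrow> f \<boxtimes> g \<in> arr C (x \<otimes> y) (x' \<otimes> y')"
    and atens_idn: "\<lbrakk>x \<in> obj C; y \<in> obj C\<rbrakk> \<Longrightarrow> idn C x \<boxtimes> idn C y = idn C (x \<otimes> y)"
    and atens_cmp: "\<lbrakk>x \<in> obj C; x' \<in> obj C; x'' \<in> obj C; y \<in> obj C; y' \<in> obj C; y'' \<in> obj C;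
        f \<in> arr C x x'; f' \<in> arr C x' x''; g \<in> arr C y y'; g' \<in> arr C y' y''\<rbrakk>
      \<Longrightarrow> (f' \<cdot> f) \<boxtimes> (g' \<cdot> g) = (f' \<boxtimes> g') \<cdot> (f \<boxtimes> g)"
    and unt_obj: "\<I> \<in> obj C"
    and asc_iso: "\<lbrakk>x \<in> obj C; y \<in> obj C; z \<in> obj C\<rbrakk>
      \<Longrightarrow> asc C x y z \<in> iso_arr C ((x \<otimes> y) \<otimes> z) (x \<otimes> (y \<otimes> z))"
    and asc_nat: "\<lbrakk>x \<in> obj C; x' \<in> obj C; y \<in> obj C; y' \<in> obj C; z \<in> obj C; z' \<in> obj C;
        f \<in> arr C x x'; g \<in> arr C y y'; h \<in> arr C z z'\<rbrakk>
      \<Longrightarrow> asc C x' y' z' \<cdot> ((f \<boxtimes> g) \<boxtimes> h) = (f \<boxtimes> (g \<boxtimes> h)) \<cdot> asc C x y z"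
    and lun_iso: "x \<in> obj C \<Longrightarrow> lun C x \<in> iso_arr C (\<I> \<otimes> x) x"
    and lun_nat: "\<lbrakk>x \<in> obj C; x' \<in> obj C; f \<in> arr C x x'\<rbrakk>
      \<Longrightarrow> lun C x' \<cdot> (idn C \<I> \<boxtimes> f) = f \<cdot> lun C x"
    and run_iso: "x \<in> obj C \<Longrightarrow> run C x \<in> iso_arr C (x \<otimes> \<I>) x"
    and run_nat: "\<lbrakk>x \<in> obj C; x' \<in> obj C; f \<in> arr C x x'\<rbrakk>
      \<Longrightarrow> run C x' \<cdot> (f \<boxtimes> idn C \<I>) = f \<cdot> run C x"
    and sym_arr: "\<lbrakk>x \<in> obj C; y \<in> obj C\<rbrakk> \<Longrightarrow> sym C x y \<in> arr C (x \<otimes> y) (y \<otimes> x)"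
    and sym_nat: "\<lbrakk>x \<in> obj C; x' \<in> obj C; y \<in> obj C; y' \<in> obj C;
        f \<in> arr C x x'; g \<in> arr C y y'\<rbrakk>
      \<Longrightarrow> sym C x' y' \<cdot> (f \<boxtimes> g) = (g \<boxtimes> f) \<cdot> sym C x y"
    and sym_sym: "\<lbrakk>x \<in> obj C; y \<in> obj C\<rbrakk> \<Longrightarrow> sym C y x \<cdot> sym C x y = idn C (x \<otimes> y)"
    and pentagon: "\<lbrakk>x \<in> obj C; y \<in> obj C; z \<in> obj C; w \<in> obj C\<rbrakk>
      \<Longrightarrow> asc C x y (z \<otimes> w) \<cdot> asc C (x \<otimes> y) z w =
          (idn C x \<boxtimes> asc C y z w) \<cdot> asc C x (y \<otimes> z) w \<cdot> (asc C x y z \<boxtimes> idn C w)"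
    and triangle: "\<lbrakk>x \<in> obj C; y \<in> obj C\<rbrakk>
      \<Longrightarrow> (idn C x \<boxtimes> lun C y) \<cdot> asc C x \<I> y = run C x \<boxtimes> idn C y"
    and hexagon: "\<lbrakk>x \<in> obj C; y \<in> obj C; z \<in> obj C\<rbrakk>
      \<Longrightarrow> asc C y z x \<cdot> sym C x (y \<otimes> z) \<cdot> asc C x y z =
          (idn C y \<boxtimes> sym C x z) \<cdot> asc C y x z \<cdot> (sym C x y \<boxtimes> idn C z)"

locale symmetric_categorical_group = symmetric_monoidal_category C + groupoid C
  for C :: "('a, 'f, 'x) smcat_scheme" (structure) +
  assumes ex_inverse: "x \<in> obj C \<Longrightarrow>
      \<exists>y \<in> obj C. isomorphic C (x \<otimes> y) \<I> \<and> isomorphic C (y \<otimes> x) \<I>"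

text \<open>Strong symmetric monoidal functors \<open>(F, \<phi>, \<phi>0)\<close> with constraints
  \<open>\<phi> x y : F x \<otimes> F y \<rightarrow> F (x \<otimes> y)\<close> and \<open>\<phi>0 : \<I> \<rightarrow> F \<I>\<close>.\<close>

locale symmetric_monoidal_functor =
  C: symmetric_monoidal_category C + D: symmetric_monoidal_category D
  for C :: "('a, 'f, 'x) smcat_scheme" and D :: "('b, 'g, 'y) smcat_scheme" +
  fixes Fo :: "'a \<Rightarrow> 'b" and Fa :: "'f \<Rightarrow> 'g"
    and \<phi> :: "'a \<Rightarrow> 'a \<Rightarrow> 'g" and \<phi>0 :: "'g"
  assumes Fo_obj: "x \<in> obj C \<Longrightarrow> Fo x \<in> obj D"
    and Fa_arr: "\<lbrakk>x \<in> obj C; y \<in> obj C; f \<in> arr C x y\<rbrakk> \<Longrightarrow> Fa f \<in> arr D (Fo x) (Fo y)"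
    and Fa_idn: "x \<in> obj C \<Longrightarrow> Fa (idn C x) = idn D (Fo x)"
    and Fa_cmp: "\<lbrakk>x \<in> obj C; y \<in> obj C; z \<in> obj C; f \<in> arr C x y; g \<in> arr C y z\<rbrakk>
      \<Longrightarrow> Fa (g \<cdot>\<^bsub>C\<^esub> f) = Fa g \<cdot>\<^bsub>D\<^esub> Fa f"
    and phi_iso: "\<lbrakk>x \<in> obj C; y \<in> obj C\<rbrakk>
      \<Longrightarrow> \<phi> x y \<in> iso_arr D (Fo x \<otimes>\<^bsub>D\<^esub> Fo y) (Fo (x \<otimes>\<^bsub>C\<^esub> y))"
    and phi_nat: "\<lbrakk>x \<in> obj C; x' \<in> obj C; y \<in> obj C; y' \<in> obj C;
        f \<in> arr C x x'; g \<in> arr C y y'\<rbrakk>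
      \<Longrightarrow> \<phi> x' y' \<cdot>\<^bsub>D\<^esub> (Fa f \<boxtimes>\<^bsub>D\<^esub> Fa g) = Fa (f \<boxtimes>\<^bsub>C\<^esub> g) \<cdot>\<^bsub>D\<^esub> \<phi> x y"
    and phi0_iso: "\<phi>0 \<in> iso_arr D \<I>\<^bsub>D\<^esub> (Fo \<I>\<^bsub>C\<^esub>)"
    and phi_asc: "\<lbrakk>x \<in> obj C; y \<in> obj C; z \<in> obj C\<rbrakk>
      \<Longrightarrow> Fa (asc C x y z) \<cdot>\<^bsub>D\<^esub> \<phi> (x \<otimes>\<^bsub>C\<^esub> y) z \<cdot>\<^bsub>D\<^esub> (\<phi> x y \<boxtimes>\<^bsub>D\<^esub> idn D (Fo z)) =
          \<phi> x (y \<otimes>\<^bsub>C\<^esub> z) \<cdot>\<^bsub>D\<^esub> (idn D (Fo x) \<boxtimes>\<^bsub>D\<^esub> \<phi> y z) \<cdot>\<^bsub>D\<^esub> asc D (Fo x) (Fo y) (Fo z)"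
    and phi_lun: "x \<in> obj C
      \<Longrightarrow> Fa (lun C x) \<cdot>\<^bsub>D\<^esub> \<phi> \<I>\<^bsub>C\<^esub> x \<cdot>\<^bsub>D\<^esub> (\<phi>0 \<boxtimes>\<^bsub>D\<^esub> idn D (Fo x)) = lun D (Fo x)"
    and phi_run: "x \<in> obj C
      \<Longrightarrow> Fa (run C x) \<cdot>\<^bsub>D\<^esub> \<phi> x \<I>\<^bsub>C\<^esub> \<cdot>\<^bsub>D\<^esub> (idn D (Fo x) \<boxtimes>\<^bsub>D\<^esub> \<phi>0) = run D (Fo x)"
    and phi_sym: "\<lbrakk>x \<in> obj C; y \<in> obj C\<rbrakk>
      \<Longrightarrow> Fa (sym C x y) \<cdot>\<^bsub>D\<^esub> \<phi> x y = \<phi> y x \<cdot>\<^bsub>D\<^esub> sym D (Fo x) (Fo y)"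


section \<open>Strict 2-categories\<close>

text \<open>1-cells compose by \<open>\<odot>\<close>; 2-cells compose vertically by \<open>\<bullet>\<close> and horizontally by \<open>\<star>\<close>.
  Every composition is written in applicative order.\<close>

record ('o, 'm, 'c) two_cat =
  Ob :: "'o set"
  Mor :: "'m set"
  Cel :: "'c set"
  src :: "'m \<Rightarrow> 'o"
  trg :: "'m \<Rightarrow> 'o"
  dom :: "'c \<Rightarrow> 'm"
  cod :: "'c \<Rightarrow> 'm"
  id1 :: "'o \<Rightarrow> 'm"
  comp1 :: "'m \<Rightarrow> 'm \<Rightarrow> 'm"  (infixr "\<odot>\<index>" 75)
  id2 :: "'m \<Rightarrow> 'c"
  vcomp :: "'c \<Rightarrow> 'c \<Rightarrow> 'c"  (infixr "\<bullet>\<index>" 55)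
  hcomp :: "'c \<Rightarrow> 'c \<Rightarrow> 'c"  (infixr "\<star>\<index>" 65)

definition mor :: "('o, 'm, 'c, 'x) two_cat_scheme \<Rightarrow> 'o \<Rightarrow> 'o \<Rightarrow> 'm set" where
  "mor L A B = {f \<in> Mor L. src L f = A \<and> trg L f = B}"

definition cells :: "('o, 'm, 'c, 'x) two_cat_scheme \<Rightarrow> 'm \<Rightarrow> 'm \<Rightarrow> 'c set" where
  "cells L f g = {\<mu> \<in> Cel L. dom L \<mu> = f \<and> cod L \<mu> = g}"

definition hom_cat :: "('o, 'm, 'c, 'x) two_cat_scheme \<Rightarrow> 'o \<Rightarrow> 'o \<Rightarrow> ('m, 'c) cat" where
  "hom_cat L A B = \<lparr>obj = mor L A B, arr = cells L, idn = id2 L, cmp = vcomp L\<rparr>"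

definition lwhisker :: "('o, 'm, 'c, 'x) two_cat_scheme \<Rightarrow> 'm \<Rightarrow> 'c \<Rightarrow> 'c"
    (infixr "\<rhd>\<index>" 70) where
  "f \<rhd>\<^bsub>L\<^esub> \<mu> = id2 L f \<star>\<^bsub>L\<^esub> \<mu>"

definition rwhisker :: "('o, 'm, 'c, 'x) two_cat_scheme \<Rightarrow> 'c \<Rightarrow> 'm \<Rightarrow> 'c"
    (infixl "\<lhd>\<index>" 70) where
  "\<mu> \<lhd>\<^bsub>L\<^esub> f = \<mu> \<star>\<^bsub>L\<^esub> id2 L f"

locale strict_two_category =
  fixes L :: "('o, 'm, 'c, 'x) two_cat_scheme" (structure)
  assumes src_Ob: "f \<in> Mor L \<Longrightarrow> src L f \<in> Ob L"
    and trg_Ob: "f \<in> Mor L \<Longrightarrow> trg L f \<in> Ob L"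
    and dom_Mor: "\<mu> \<in> Cel L \<Longrightarrow> dom L \<mu> \<in> Mor L"
    and cod_Mor: "\<mu> \<in> Cel L \<Longrightarrow> cod L \<mu> \<in> Mor L"
    and src_parallel: "\<mu> \<in> Cel L \<Longrightarrow> src L (dom L \<mu>) = src L (cod L \<mu>)"
    and trg_parallel: "\<mu> \<in> Cel L \<Longrightarrow> trg L (dom L \<mu>) = trg L (cod L \<mu>)"
    and hom_category: "\<lbrakk>A \<in> Ob L; B \<in> Ob L\<rbrakk> \<Longrightarrow> category (hom_cat L A B)"
    and id1_mor: "A \<in> Ob L \<Longrightarrow> id1 L A \<in> mor L A A"
    and comp1_mor: "\<lbrakk>f \<in> mor L A B; g \<in> mor L B C\<rbrakk> \<Longrightarrow> g \<odot> f \<in> mor L A C"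
    and comp1_id1: "f \<in> mor L A B \<Longrightarrow> f \<odot> id1 L A = f"
    and id1_comp1: "f \<in> mor L A B \<Longrightarrow> id1 L B \<odot> f = f"
    and comp1_assoc: "\<lbrakk>f \<in> mor L A B; g \<in> mor L B C; h \<in> mor L C D\<rbrakk>
      \<Longrightarrow> (h \<odot> g) \<odot> f = h \<odot> (g \<odot> f)"
    and hcomp_cells: "\<lbrakk>f \<in> mor L A B; f' \<in> mor L A B; g \<in> mor L B C; g' \<in> mor L B C;
        \<mu> \<in> cells L f f'; \<nu> \<in> cells L g g'\<rbrakk> \<Longrightarrow> \<nu> \<star> \<mu> \<in> cells L (g \<odot> f) (g' \<odot> f')"
    and hcomp_id2: "\<lbrakk>f \<in> mor L A B; g \<in> mor L B C\<rbrakk> \<Longrightarrow> id2 L g \<star> id2 L f = id2 L (g \<odot> f)"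
    and interchange: "\<lbrakk>f \<in> mor L A B; f' \<in> mor L A B; f'' \<in> mor L A B;
        g \<in> mor L B C; g' \<in> mor L B C; g'' \<in> mor L B C;
        \<mu> \<in> cells L f f'; \<mu>' \<in> cells L f' f''; \<nu> \<in> cells L g g'; \<nu>' \<in> cells L g' g''\<rbrakk>
      \<Longrightarrow> (\<nu>' \<bullet> \<nu>) \<star> (\<mu>' \<bullet> \<mu>) = (\<nu>' \<star> \<mu>') \<bullet> (\<nu> \<star> \<mu>)"
    and hcomp_id1: "\<lbrakk>f \<in> mor L A B; f' \<in> mor L A B; \<mu> \<in> cells L f f'\<rbrakk>
      \<Longrightarrow> \<mu> \<star> id2 L (id1 L A) = \<mu>"
    and id1_hcomp: "\<lbrakk>f \<in> mor L A B; f' \<in> mor L A B; \<mu> \<in> cells L f f'\<rbrakk>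
      \<Longrightarrow> id2 L (id1 L B) \<star> \<mu> = \<mu>"
    and hcomp_assoc: "\<lbrakk>f \<in> mor L A B; f' \<in> mor L A B; g \<in> mor L B C; g' \<in> mor L B C;
        h \<in> mor L C D; h' \<in> mor L C D;
        \<mu> \<in> cells L f f'; \<nu> \<in> cells L g g'; \<xi> \<in> cells L h h'\<rbrakk>
      \<Longrightarrow> (\<xi> \<star> \<nu>) \<star> \<mu> = \<xi> \<star> (\<nu> \<star> \<mu>)"

definition iso_mor :: "('o, 'm, 'c, 'x) two_cat_scheme \<Rightarrow> 'm \<Rightarrow> 'm \<Rightarrow> bool" where
  "iso_mor L f g \<longleftrightarrow> isomorphic (hom_cat L (src L f) (trg L f)) f g"

context
  fixes L :: "('o, 'm, 'c, 'x) two_cat_scheme" (structure)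
begin

text \<open>A bicategorical product: for each \<open>X\<close> the functor from \<open>L(X, P)\<close> to \<open>L(X, A) \<times> L(X, B)\<close>
  induced by the projections is an equivalence, i.e. essentially surjective and fully faithful.\<close>

definition is_product :: "'o \<Rightarrow> 'o \<Rightarrow> 'o \<Rightarrow> 'm \<Rightarrow> 'm \<Rightarrow> bool" where
  "is_product A B P p q \<longleftrightarrow>
     p \<in> mor L P A \<and> q \<in> mor L P B \<and>
     (\<forall>X \<in> Ob L.
        (\<forall>a \<in> mor L X A. \<forall>b \<in> mor L X B. \<exists>u \<in> mor L X P.
           iso_mor L (p \<odot> u) a \<and> iso_mor L (q \<odot> u) b) \<and>
        (\<forall>u \<in> mor L X P. \<forall>v \<in> mor L X P.
           \<forall>\<mu> \<in> cells L (p \<odot> u) (p \<odot> v). \<forall>\<nu> \<in> cells L (q \<odot> u) (q \<odot> v).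
           \<exists>!\<xi>. \<xi> \<in> cells L u v \<and> p \<rhd> \<xi> = \<mu> \<and> q \<rhd> \<xi> = \<nu>))"

definition is_coproduct :: "'o \<Rightarrow> 'o \<Rightarrow> 'o \<Rightarrow> 'm \<Rightarrow> 'm \<Rightarrow> bool" where
  "is_coproduct A B P i j \<longleftrightarrow>
     i \<in> mor L A P \<and> j \<in> mor L B P \<and>
     (\<forall>X \<in> Ob L.
        (\<forall>a \<in> mor L A X. \<forall>b \<in> mor L B X. \<exists>u \<in> mor L P X.
           iso_mor L (u \<odot> i) a \<and> iso_mor L (u \<odot> j) b) \<and>
        (\<forall>u \<in> mor L P X. \<forall>v \<in> mor L P X.
           \<forall>\<mu> \<in> cells L (u \<odot> i) (v \<odot> i). \<forall>\<nu> \<in> cells L (u \<odot> j) (v \<odot> j).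
           \<exists>!\<xi>. \<xi> \<in> cells L u v \<and> \<xi> \<lhd> i = \<mu> \<and> \<xi> \<lhd> j = \<nu>))"

definition faithful :: "'m \<Rightarrow> bool" where
  "faithful f \<longleftrightarrow> f \<in> Mor L \<and>
     (\<forall>X \<in> Ob L. \<forall>g \<in> mor L X (src L f). \<forall>h \<in> mor L X (src L f).
        \<forall>\<mu> \<in> cells L g h. \<forall>\<nu> \<in> cells L g h. f \<rhd> \<mu> = f \<rhd> \<nu> \<longrightarrow> \<mu> = \<nu>)"

definition cofaithful :: "'m \<Rightarrow> bool" where
  "cofaithful f \<longleftrightarrow> f \<in> Mor L \<and>
     (\<forall>X \<in> Ob L. \<forall>g \<in> mor L (trg L f) X. \<forall>h \<in> mor L (trg L f) X.
        \<forall>\<mu> \<in> cells L g h. \<forall>\<nu> \<in> cells L g h. \<mu> \<lhd> f = \<nu> \<lhd> f \<longrightarrow> \<mu> = \<nu>)"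

end


section \<open>Locally SCG categories\<close>

text \<open>\<open>zro A B\<close> is the unit object of \<open>L(A, B)\<close>. The constraints of the symmetric monoidal
  functors \<open>f \<odot> -\<close> and \<open>- \<odot> f\<close> are
  \<open>lcon f g h : (f \<odot> g) \<otimes> (f \<odot> h) \<Rightarrow> f \<odot> (g \<otimes> h)\<close> and
  \<open>rcon f g h : (g \<odot> f) \<otimes> (h \<odot> f) \<Rightarrow> (g \<otimes> h) \<odot> f\<close>.\<close>

record ('o, 'm, 'c) lscg = "('o, 'm, 'c) two_cat" +
  zro :: "'o \<Rightarrow> 'o \<Rightarrow> 'm"  ("\<zero>\<index>")
  mtens :: "'m \<Rightarrow> 'm \<Rightarrow> 'm"
  ctens :: "'c \<Rightarrow> 'c \<Rightarrow> 'c"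
  masc :: "'m \<Rightarrow> 'm \<Rightarrow> 'm \<Rightarrow> 'c"
  mlun :: "'m \<Rightarrow> 'c"
  mrun :: "'m \<Rightarrow> 'c"
  msym :: "'m \<Rightarrow> 'm \<Rightarrow> 'c"
  lcon :: "'m \<Rightarrow> 'm \<Rightarrow> 'm \<Rightarrow> 'c"
  rcon :: "'m \<Rightarrow> 'm \<Rightarrow> 'm \<Rightarrow> 'c"

definition hom_scg :: "('o, 'm, 'c, 'x) lscg_scheme \<Rightarrow> 'o \<Rightarrow> 'o \<Rightarrow> ('m, 'c) smcat" where
  "hom_scg L A B =
     \<lparr>obj = mor L A B, arr = cells L, idn = id2 L, cmp = vcomp L,
      tens = mtens L, atens = ctens L, unt = \<zero>\<^bsub>L\<^esub> A B,
      asc = masc L, lun = mlun L, run = mrun L, sym = msym L\<rparr>"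

locale locally_SCG_category = strict_two_category L
  for L :: "('o, 'm, 'c, 'x) lscg_scheme" (structure) +
  assumes hom_SCG: "\<lbrakk>A \<in> Ob L; B \<in> Ob L\<rbrakk> \<Longrightarrow> symmetric_categorical_group (hom_scg L A B)"
    and comp_zero: "\<lbrakk>A \<in> Ob L; f \<in> mor L B C\<rbrakk> \<Longrightarrow> f \<odot> \<zero> A B = \<zero> A C"
    and zero_comp: "\<lbrakk>C \<in> Ob L; f \<in> mor L A B\<rbrakk> \<Longrightarrow> \<zero> B C \<odot> f = \<zero> A C"
    and postcomp_monoidal: "\<lbrakk>A \<in> Ob L; f \<in> mor L B C\<rbrakk> \<Longrightarrow>
      symmetric_monoidal_functor (hom_scg L A B) (hom_scg L A C)
        (\<lambda>g. f \<odot> g) (\<lambda>\<mu>. f \<rhd> \<mu>) (lcon L f) (id2 L (\<zero> A C))"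
    and precomp_monoidal: "\<lbrakk>C \<in> Ob L; f \<in> mor L A B\<rbrakk> \<Longrightarrow>
      symmetric_monoidal_functor (hom_scg L B C) (hom_scg L A C)
        (\<lambda>g. g \<odot> f) (\<lambda>\<mu>. \<mu> \<lhd> f) (rcon L f) (id2 L (\<zero> A C))"
    and zero_whisker: "\<lbrakk>f \<in> mor L A B; g \<in> mor L A B; \<mu> \<in> cells L f g; C \<in> Ob L\<rbrakk>
      \<Longrightarrow> \<zero> B C \<rhd> \<mu> = id2 L (\<zero> A C)"
    and whisker_zero: "\<lbrakk>f \<in> mor L B C; g \<in> mor L B C; \<mu> \<in> cells L f g; A \<in> Ob L\<rbrakk>
      \<Longrightarrow> \<mu> \<lhd> \<zero> A B = id2 L (\<zero> A C)"
    and ex_zero_object: "\<exists>Z \<in> Ob L. \<forall>A \<in> Ob L.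
        (\<forall>f \<in> mor L Z A. \<exists>!\<mu>. \<mu> \<in> cells L f (\<zero> Z A)) \<and>
        (\<forall>f \<in> mor L A Z. \<exists>!\<mu>. \<mu> \<in> cells L f (\<zero> A Z))"
    and ex_product: "\<lbrakk>A \<in> Ob L; B \<in> Ob L\<rbrakk> \<Longrightarrow> \<exists>P \<in> Ob L. \<exists>p q. is_product L A B P p q"
    and ex_coproduct: "\<lbrakk>A \<in> Ob L; B \<in> Ob L\<rbrakk> \<Longrightarrow> \<exists>P \<in> Ob L. \<exists>i j. is_coproduct L A B P i j"


section \<open>2-kernels, 2-cokernels and exactness\<close>

context
  fixes L :: "('o, 'm, 'c, 'x) lscg_scheme" (structure)
begin

text \<open>\<open>is_two_kernel f k \<alpha>\<close>: the morphism \<open>k\<close> with \<open>\<alpha> : f \<odot> k \<Rightarrow> \<zero>\<close> is a 2-kernel of \<open>f\<close>;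
  \<open>is_two_cokernel f c \<alpha>\<close>: the morphism \<open>c\<close> with \<open>\<alpha> : c \<odot> f \<Rightarrow> \<zero>\<close> is a 2-cokernel of \<open>f\<close>.\<close>

definition is_two_kernel :: "'m \<Rightarrow> 'm \<Rightarrow> 'c \<Rightarrow> bool" where
  "is_two_kernel f k \<alpha> \<longleftrightarrow> (\<exists>A B K.
     f \<in> mor L A B \<and> k \<in> mor L K A \<and> \<alpha> \<in> cells L (f \<odot> k) (\<zero> K B) \<and>
     (\<forall>Z \<in> Ob L. \<forall>z \<in> mor L Z A. \<forall>\<beta> \<in> cells L (f \<odot> z) (\<zero> Z B).
        \<exists>u \<in> mor L Z K. \<exists>\<gamma> \<in> cells L z (k \<odot> u). \<beta> = (\<alpha> \<lhd> u) \<bullet> (f \<rhd> \<gamma>)) \<and>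
     (\<forall>Z \<in> Ob L. \<forall>u \<in> mor L Z K. \<forall>v \<in> mor L Z K. \<forall>l \<in> cells L (k \<odot> u) (k \<odot> v).
        (\<alpha> \<lhd> v) \<bullet> (f \<rhd> l) = \<alpha> \<lhd> u \<longrightarrow>
        (\<exists>!\<mu>. \<mu> \<in> cells L u v \<and> k \<rhd> \<mu> = l)))"

definition is_two_cokernel :: "'m \<Rightarrow> 'm \<Rightarrow> 'c \<Rightarrow> bool" where
  "is_two_cokernel f c \<alpha> \<longleftrightarrow> (\<exists>A B C.
     f \<in> mor L A B \<and> c \<in> mor L B C \<and> \<alpha> \<in> cells L (c \<odot> f) (\<zero> A C) \<and>
     (\<forall>Z \<in> Ob L. \<forall>z \<in> mor L B Z. \<forall>\<beta> \<in> cells L (z \<odot> f) (\<zero> A Z).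
        \<exists>u \<in> mor L C Z. \<exists>\<gamma> \<in> cells L z (u \<odot> c). \<beta> = (u \<rhd> \<alpha>) \<bullet> (\<gamma> \<lhd> f)) \<and>
     (\<forall>Z \<in> Ob L. \<forall>u \<in> mor L C Z. \<forall>v \<in> mor L C Z. \<forall>l \<in> cells L (u \<odot> c) (v \<odot> c).
        (v \<rhd> \<alpha>) \<bullet> (l \<lhd> f) = u \<rhd> \<alpha> \<longrightarrow>
        (\<exists>!\<mu>. \<mu> \<in> cells L u v \<and> \<mu> \<lhd> c = l)))"

definition two_kernel :: "'m \<Rightarrow> bool" where
  "two_kernel k \<longleftrightarrow> (\<exists>f \<alpha>. is_two_kernel f k \<alpha>)"

definition two_cokernel :: "'m \<Rightarrow> bool" where
  "two_cokernel c \<longleftrightarrow> (\<exists>f \<alpha>. is_two_cokernel f c \<alpha>)"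

definition has_two_kernels :: bool where
  "has_two_kernels \<longleftrightarrow> (\<forall>f \<in> Mor L. \<exists>k \<alpha>. is_two_kernel f k \<alpha>)"

definition has_two_cokernels :: bool where
  "has_two_cokernels \<longleftrightarrow> (\<forall>f \<in> Mor L. \<exists>c \<alpha>. is_two_cokernel f c \<alpha>)"

definition two_kernel_of_its_two_cokernel :: "'m \<Rightarrow> bool" where
  "two_kernel_of_its_two_cokernel m \<longleftrightarrow>
     (\<forall>c \<beta>. is_two_cokernel m c \<beta> \<longrightarrow> is_two_kernel c m \<beta>)"

definition two_cokernel_of_its_two_kernel :: "'m \<Rightarrow> bool" where
  "two_cokernel_of_its_two_kernel e \<longleftrightarrow>
     (\<forall>k \<beta>. is_two_kernel e k \<beta> \<longrightarrow> is_two_cokernel k e \<beta>)"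

text \<open>Weak closedness of the 2-ideal whose null morphisms are the \<open>\<zero> A B\<close> and whose null
  2-cells are the identities on them.\<close>

definition zero_ideal_weakly_closed :: bool where
  "zero_ideal_weakly_closed \<longleftrightarrow>
     (\<forall>A B K f k \<alpha>. f \<in> mor L A B \<longrightarrow> k \<in> mor L K A \<longrightarrow> is_two_kernel f k \<alpha> \<longrightarrow>
        (\<forall>S \<in> Ob L. \<forall>s \<in> mor L S K. \<forall>\<delta> \<in> cells L (k \<odot> s) (\<zero> S A).
           f \<rhd> \<delta> = \<alpha> \<lhd> s \<longrightarrow> (\<exists>\<psi> \<in> cells L s (\<zero> S K). k \<rhd> \<psi> = \<delta>)) \<and>
        (\<forall>S \<in> Ob L. \<forall>\<mu> \<in> cells L (\<zero> S K) (\<zero> S K).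
           k \<rhd> \<mu> = id2 L (\<zero> S A) \<longrightarrow> \<mu> = id2 L (\<zero> S K))) \<and>
     (\<forall>A B C f c \<alpha>. f \<in> mor L A B \<longrightarrow> c \<in> mor L B C \<longrightarrow> is_two_cokernel f c \<alpha> \<longrightarrow>
        (\<forall>S \<in> Ob L. \<forall>s \<in> mor L C S. \<forall>\<delta> \<in> cells L (s \<odot> c) (\<zero> B S).
           \<delta> \<lhd> f = s \<rhd> \<alpha> \<longrightarrow> (\<exists>\<psi> \<in> cells L s (\<zero> C S). \<psi> \<lhd> c = \<delta>)) \<and>
        (\<forall>S \<in> Ob L. \<forall>\<mu> \<in> cells L (\<zero> C S) (\<zero> C S).
           \<mu> \<lhd> c = id2 L (\<zero> B S) \<longrightarrow> \<mu> = id2 L (\<zero> C S)))"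

definition relatively_exact :: bool where
  "relatively_exact \<longleftrightarrow>
     locally_SCG_category L \<and> has_two_kernels \<and> has_two_cokernels \<and>
     (\<forall>f. faithful L f \<longrightarrow> two_kernel_of_its_two_cokernel f) \<and>
     (\<forall>f. cofaithful L f \<longrightarrow> two_cokernel_of_its_two_kernel f)"

definition weakly_Puppe_two_exact :: bool where
  "weakly_Puppe_two_exact \<longleftrightarrow>
     has_two_kernels \<and> has_two_cokernels \<and>
     zero_ideal_weakly_closed \<and>
     (\<forall>m. two_kernel m \<longrightarrow> two_kernel_of_its_two_cokernel m) \<and>
     (\<forall>e. two_cokernel e \<longrightarrow> two_cokernel_of_its_two_kernel e) \<and>
     (\<forall>f \<in> Mor L. \<exists>e m. two_cokernel e \<and> two_kernel m \<and> trg L e = src L m \<and>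
        src L e = src L f \<and> trg L m = trg L f \<and> iso_mor L f (m \<odot> e))"

end

end

theory Submission
  imports Defs
begin

text \<open>
  The only substantial point is the factorization in a relatively exact category. Let
  \<open>k\<close> be the 2-kernel of \<open>f\<close>, let \<open>e\<close> be the 2-cokernel of \<open>k\<close>, and write \<open>f \<cong> m e\<close>. It suffices
  that \<open>m\<close> is faithful, and tensoring with inverses reduces this to 2-cells \<open>\<mu> : 0 \<Rightarrow> 0\<close> with
  \<open>m \<mu> = 1\<close>. Such a \<open>\<mu>\<close> is classified by a morphism \<open>x\<close> out of the 2-cokernel of \<open>X \<rightarrow> 0\<close>, and
  \<open>m x \<cong> 0\<close>. Let \<open>q\<close> be the 2-cokernel of \<open>x\<close>, so that \<open>q \<mu> = 1\<close> and \<open>m \<cong> n q\<close>. As a composite of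
  2-cokernels, \<open>q e\<close> is cofaithful, hence a 2-cokernel of its 2-kernel \<open>l\<close>. Since \<open>f \<cong> n q e\<close>,
  \<open>l\<close> factors through \<open>k\<close>, so \<open>e\<close> factors as \<open>r q e\<close>; comparing the structure 2-cells gives
  \<open>1 \<cong> r q\<close>, and therefore \<open>\<mu> = 1\<close>.
\<close>

section \<open>Cancellation and tensoring in symmetric categorical groups\<close>

context category
begin

lemma iso_arr_in_arr: "f \<in> iso_arr C x y \<Longrightarrow> f \<in> arr C x y"
  by (simp add: iso_arr_def)

lemma iso_cancel_right:
  assumes "x \<in> obj C" "y \<in> obj C" "z \<in> obj C" "f \<in> iso_arr C x y"
    and "g \<in> arr C y z" "h \<in> arr C y z" "g \<cdot> f = h \<cdot> f"
  shows "g = h"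
proof -
  obtain f' where f: "f \<in> arr C x y" "f' \<in> arr C y x" "f \<cdot> f' = idn C y"
    using assms(4) by (auto simp: iso_arr_def)
  have "g = g \<cdot> (f \<cdot> f')" using assms f by (simp add: cmp_idn)
  also have "\<dots> = (g \<cdot> f) \<cdot> f'"
    using assms f cmp_assoc[of y x y z f' f g] by simp
  also have "\<dots> = h \<cdot> (f \<cdot> f')"
    using assms f cmp_assoc[of y x y z f' f h] by simp
  also have "\<dots> = h" using assms f by (simp add: cmp_idn)
  finally show ?thesis .
qed

end

text \<open>Tensoring further with an inverse \<open>z\<close> of \<open>y\<close> turns the
  hypothesis into the triviality of \<open>a \<boxtimes> idn C \<I>\<close>, and the right unitor
  conjugates that to \<open>a\<close> itself.\<close>

lemma (in symmetric_categorical_group) atens_idn_reflects_idn: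
  assumes x: "x \<in> obj C" and y: "y \<in> obj C" and a: "a \<in> arr C x x"
    and eq: "a \<boxtimes> idn C y = idn C (x \<otimes> y)"
  shows "a = idn C x"
proof -
  obtain z where z: "z \<in> obj C" and "isomorphic C (y \<otimes> z) \<I>"
    using ex_inverse[OF y] by blast
  then obtain i where i: "i \<in> arr C (y \<otimes> z) \<I>"
    by (auto simp: isomorphic_def iso_arr_def)
  note ob = x y z unt_obj tens_obj
  have as: "asc C x y z \<in> iso_arr C ((x \<otimes> y) \<otimes> z) (x \<otimes> (y \<otimes> z))"
    by (rule asc_iso[OF x y z])
  \<comment> \<open>Naturality of the associator moves \<open>idn C z\<close> inside; the associator
    then cancels because it is invertible.\<close>
  have "(a \<boxtimes> idn C (y \<otimes> z)) \<cdot> asc C x y z = asc C x y z \<cdot> ((a \<boxtimes> idn C y) \<boxtimes> idn C z)"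
    using asc_nat[OF x x y y z z a idn_arr[OF y] idn_arr[OF z]] by (simp add: ob atens_idn)
  also have "\<dots> = asc C x y z"
    using cmp_idn[OF _ _ iso_arr_in_arr[OF as]] by (simp add: eq ob atens_idn)
  also have "\<dots> = idn C (x \<otimes> (y \<otimes> z)) \<cdot> asc C x y z"
    using idn_cmp[OF _ _ iso_arr_in_arr[OF as]] by (simp add: ob)
  finally have "a \<boxtimes> idn C (y \<otimes> z) = idn C (x \<otimes> (y \<otimes> z))"
    by (rule iso_cancel_right[where z = "x \<otimes> (y \<otimes> z)", OF _ _ _ as, rotated -1])
      (simp_all add: ob a atens_arr idn_arr)
  then have ayz: "a \<boxtimes> idn C (y \<otimes> z) = idn C x \<boxtimes> idn C (y \<otimes> z)"
    by (simp add: ob atens_idn)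
  have xi: "idn C x \<boxtimes> i \<in> iso_arr C (x \<otimes> (y \<otimes> z)) (x \<otimes> \<I>)"
    using atens_arr[OF x x _ _ idn_arr[OF x] i] all_iso ob by simp
  \<comment> \<open>By bifunctoriality \<open>a\<close> slides past \<open>i\<close>, which replaces
    the second factor \<open>y \<otimes> z\<close> by \<open>\<I>\<close>.\<close>
  have "(a \<boxtimes> idn C \<I>) \<cdot> (idn C x \<boxtimes> i) = a \<boxtimes> i"
    using atens_cmp[OF x x x _ _ _ idn_arr[OF x] a i idn_arr] ob
    by (simp add: cmp_idn[OF _ _ a] idn_cmp[OF _ _ i])
  also have "\<dots> = (idn C x \<boxtimes> i) \<cdot> (a \<boxtimes> idn C (y \<otimes> z))"
    using atens_cmp[OF x x x _ _ _ a idn_arr[OF x] idn_arr i] ob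
    by (simp add: idn_cmp[OF _ _ a] cmp_idn[OF _ _ i])
  also have "\<dots> = idn C (x \<otimes> \<I>) \<cdot> (idn C x \<boxtimes> i)"
    using cmp_idn[OF _ _ iso_arr_in_arr[OF xi]] idn_cmp[OF _ _ iso_arr_in_arr[OF xi]]
    by (simp add: ayz atens_idn ob)
  finally have "a \<boxtimes> idn C \<I> = idn C (x \<otimes> \<I>)"
    by (rule iso_cancel_right[where z = "x \<otimes> \<I>", OF _ _ _ xi, rotated -1])
      (simp_all add: ob a atens_arr idn_arr)
  then have "a \<cdot> run C x = idn C x \<cdot> run C x"
    using run_nat[OF x x a] cmp_idn[OF _ _ iso_arr_in_arr[OF run_iso[OF x]]]
      idn_cmp[OF _ _ iso_arr_in_arr[OF run_iso[OF x]]]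
    by (simp add: ob)
  then show ?thesis
    by (rule iso_cancel_right[OF _ _ _ run_iso[OF x] a idn_arr[OF x], rotated -1])
      (simp_all add: ob)
qed

section \<open>Whiskering calculus in a strict 2-category\<close>

context strict_two_category
begin

lemma mor_Ob: "f \<in> mor L A B \<Longrightarrow> A \<in> Ob L" "f \<in> mor L A B \<Longrightarrow> B \<in> Ob L"
  using src_Ob trg_Ob by (auto simp: mor_def)

lemma cells_cod_mor:
  assumes "\<mu> \<in> cells L f g" "f \<in> mor L A B"
  shows "g \<in> mor L A B"
  using assms cod_Mor[of \<mu>] src_parallel[of \<mu>] trg_parallel[of \<mu>]
  by (simp add: cells_def mor_def)

text \<open>The boundary of a 2-cell consists of parallel morphisms of some hom-category, so the
  vertical composition rules below need no typing hypotheses on morphisms.\<close>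

lemma cells_domE:
  assumes "\<mu> \<in> cells L f g"
  obtains A B where "f \<in> mor L A B" "g \<in> mor L A B"
proof -
  have "f \<in> mor L (src L f) (trg L f)"
    using assms dom_Mor[of \<mu>] by (simp add: cells_def mor_def)
  then show thesis using that cells_cod_mor[OF assms] by blast
qed

lemma id2_cells: "f \<in> mor L A B \<Longrightarrow> id2 L f \<in> cells L f f"
  using category.idn_arr[OF hom_category, of A B f] by (simp add: hom_cat_def mor_Ob)

lemma vcomp_cells:
  assumes "\<nu> \<in> cells L g h" "\<mu> \<in> cells L f g"
  shows "\<nu> \<bullet> \<mu> \<in> cells L f h"
proof -
  obtain A B where f: "f \<in> mor L A B" and g: "g \<in> mor L A B"
    by (rule cells_domE[OF assms(2)])
  have "h \<in> mor L A B"
    by (rule cells_cod_mor[OF assms(1) g])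
  with f g show ?thesis
    using category.cmp_arr[OF hom_category, of A B f g h \<mu> \<nu>] assms
    by (simp add: hom_cat_def mor_Ob)
qed

lemma vcomp_assoc:
  assumes "\<xi> \<in> cells L h j" "\<nu> \<in> cells L g h" "\<mu> \<in> cells L f g"
  shows "(\<xi> \<bullet> \<nu>) \<bullet> \<mu> = \<xi> \<bullet> (\<nu> \<bullet> \<mu>)"
proof -
  obtain A B where f: "f \<in> mor L A B" and g: "g \<in> mor L A B"
    by (rule cells_domE[OF assms(3)])
  have h: "h \<in> mor L A B"
    by (rule cells_cod_mor[OF assms(2) g])
  have "j \<in> mor L A B"
    by (rule cells_cod_mor[OF assms(1) h])
  with f g h show ?thesis
    using category.cmp_assoc[OF hom_category, of A B f g h j \<mu> \<nu> \<xi>] assms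
    by (simp add: hom_cat_def mor_Ob)
qed

lemma vcomp_id2: "\<mu> \<in> cells L f g \<Longrightarrow> \<mu> \<bullet> id2 L f = \<mu>"
  and id2_vcomp: "\<mu> \<in> cells L f g \<Longrightarrow> id2 L g \<bullet> \<mu> = \<mu>"
proof -
  assume \<mu>: "\<mu> \<in> cells L f g"
  then obtain A B where "f \<in> mor L A B" "g \<in> mor L A B"
    by (rule cells_domE)
  then show "\<mu> \<bullet> id2 L f = \<mu>" "id2 L g \<bullet> \<mu> = \<mu>"
    using category.cmp_idn[OF hom_category, of A B f g \<mu>]
      category.idn_cmp[OF hom_category, of A B f g \<mu>] \<mu>
    by (simp_all add: hom_cat_def mor_Ob)
qed

lemma lwhisker_cells:
  assumes "f \<in> mor L B C" "g \<in> mor L A B" "\<mu> \<in> cells L g h"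
  shows "f \<rhd> \<mu> \<in> cells L (f \<odot> g) (f \<odot> h)"
  unfolding lwhisker_def
  by (rule hcomp_cells[OF assms(2) cells_cod_mor[OF assms(3,2)] assms(1) assms(1) assms(3)
        id2_cells[OF assms(1)]])

lemma rwhisker_cells:
  assumes "f \<in> mor L A B" "g \<in> mor L B C" "\<mu> \<in> cells L g h"
  shows "\<mu> \<lhd> f \<in> cells L (g \<odot> f) (h \<odot> f)"
  unfolding rwhisker_def
  by (rule hcomp_cells[OF assms(1) assms(1) assms(2) cells_cod_mor[OF assms(3,2)]
        id2_cells[OF assms(1)] assms(3)])

lemma lwhisker_id2: "f \<in> mor L B C \<Longrightarrow> g \<in> mor L A B \<Longrightarrow> f \<rhd> id2 L g = id2 L (f \<odot> g)"
  by (simp add: lwhisker_def hcomp_id2)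

lemma rwhisker_id2: "f \<in> mor L A B \<Longrightarrow> g \<in> mor L B C \<Longrightarrow> id2 L g \<lhd> f = id2 L (g \<odot> f)"
  by (simp add: rwhisker_def hcomp_id2)

lemma id1_lwhisker:
  assumes "f \<in> mor L A B" "\<mu> \<in> cells L f g"
  shows "id1 L B \<rhd> \<mu> = \<mu>"
  unfolding lwhisker_def
  by (rule id1_hcomp[OF assms(1) cells_cod_mor[OF assms(2,1)] assms(2)])

lemma rwhisker_id1:
  assumes "f \<in> mor L A B" "\<mu> \<in> cells L f g"
  shows "\<mu> \<lhd> id1 L A = \<mu>"
  unfolding rwhisker_def
  by (rule hcomp_id1[OF assms(1) cells_cod_mor[OF assms(2,1)] assms(2)])

lemma lwhisker_vcomp:
  assumes "f \<in> mor L B C" "g \<in> mor L A B" "\<mu> \<in> cells L g h" "\<nu> \<in> cells L h j"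
  shows "f \<rhd> (\<nu> \<bullet> \<mu>) = (f \<rhd> \<nu>) \<bullet> (f \<rhd> \<mu>)"
proof -
  have "h \<in> mor L A B" "j \<in> mor L A B"
    using assms cells_cod_mor by blast+
  then show ?thesis
    using interchange[of g A B h j f C f f \<mu> \<nu> "id2 L f" "id2 L f"] assms
      vcomp_id2[OF id2_cells[OF assms(1)]] id2_cells[OF assms(1)]
    by (simp add: lwhisker_def)
qed

lemma rwhisker_vcomp:
  assumes "f \<in> mor L A B" "g \<in> mor L B C" "\<mu> \<in> cells L g h" "\<nu> \<in> cells L h j"
  shows "(\<nu> \<bullet> \<mu>) \<lhd> f = (\<nu> \<lhd> f) \<bullet> (\<mu> \<lhd> f)"
proof -
  have "h \<in> mor L B C" "j \<in> mor L B C"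
    using assms cells_cod_mor by blast+
  then show ?thesis
    using interchange[of f A B f f g C h j "id2 L f" "id2 L f" \<mu> \<nu>] assms
      vcomp_id2[OF id2_cells[OF assms(1)]] id2_cells[OF assms(1)]
    by (simp add: rwhisker_def)
qed

lemma lwhisker_comp1:
  assumes "h \<in> mor L A B" "f \<in> mor L B C" "g \<in> mor L C D" "\<mu> \<in> cells L h h'"
  shows "(g \<odot> f) \<rhd> \<mu> = g \<rhd> (f \<rhd> \<mu>)"
proof -
  have "h' \<in> mor L A B" using assms cells_cod_mor by blast
  then show ?thesis
    using hcomp_assoc[of h A B h' f C f g D g \<mu> "id2 L f" "id2 L g"] assms
    by (simp add: lwhisker_def hcomp_id2 id2_cells)
qed

lemma rwhisker_comp1:
  assumes "f \<in> mor L A B" "g \<in> mor L B C" "h \<in> mor L C D" "\<mu> \<in> cells L h h'"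
  shows "\<mu> \<lhd> (g \<odot> f) = (\<mu> \<lhd> g) \<lhd> f"
proof -
  have "h' \<in> mor L C D" using assms cells_cod_mor by blast
  then show ?thesis
    using hcomp_assoc[of f A B f g C g h D h' "id2 L f" "id2 L g" \<mu>] assms
    by (simp add: rwhisker_def hcomp_id2 id2_cells)
qed

lemma lwhisker_rwhisker:
  assumes "f \<in> mor L A B" "h \<in> mor L B C" "g \<in> mor L C D" "\<mu> \<in> cells L h h'"
  shows "g \<rhd> (\<mu> \<lhd> f) = (g \<rhd> \<mu>) \<lhd> f"
proof -
  have "h' \<in> mor L B C" using assms cells_cod_mor by blast
  then show ?thesis
    using hcomp_assoc[of f A B f h C h' g D g "id2 L f" \<mu> "id2 L g"] assms
    by (simp add: lwhisker_def rwhisker_def id2_cells)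
qed

text \<open>Both sides are the horizontal composite \<open>\<nu> \<star> \<mu>\<close>. When
  \<open>f'\<close> or \<open>g'\<close> is a zero morphism, one factor becomes an identity; this is
  how most of the later cancellations arise.\<close>

lemma whisker_exchange:
  assumes f: "f \<in> mor L A B" and g: "g \<in> mor L B C"
    and \<mu>: "\<mu> \<in> cells L f f'" and \<nu>: "\<nu> \<in> cells L g g'"
  shows "(\<nu> \<lhd> f') \<bullet> (g \<rhd> \<mu>) = (g' \<rhd> \<mu>) \<bullet> (\<nu> \<lhd> f)"
proof -
  have f': "f' \<in> mor L A B" and g': "g' \<in> mor L B C" using assms cells_cod_mor by blast+
  have "(\<nu> \<lhd> f') \<bullet> (g \<rhd> \<mu>) = \<nu> \<star> \<mu>"
    using interchange[OF f f' f' g g g' \<mu> id2_cells[OF f'] id2_cells[OF g] \<nu>] \<mu> \<nu>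
    by (simp add: lwhisker_def rwhisker_def id2_vcomp vcomp_id2)
  also have "\<dots> = (g' \<rhd> \<mu>) \<bullet> (\<nu> \<lhd> f)"
    using interchange[OF f f f' g g' g' id2_cells[OF f] \<mu> \<nu> id2_cells[OF g']] \<mu> \<nu>
    by (simp add: lwhisker_def rwhisker_def id2_vcomp vcomp_id2)
  finally show ?thesis .
qed

end

section \<open>2-kernels and 2-cokernels between given objects\<close>

lemma mor_unique:
  assumes "f \<in> mor L A B" "f \<in> mor L A' B'"
  shows "A' = A" "B' = B"
  using assms by (auto simp: mor_def)

lemma two_kernelE:
  assumes "is_two_kernel L f k \<alpha>" "f \<in> mor L A B"
  obtains K where "k \<in> mor L K A" "\<alpha> \<in> cells L (f \<odot>\<^bsub>L\<^esub> k) (\<zero>\<^bsub>L\<^esub> K B)"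
proof -
  obtain A' B' K where "f \<in> mor L A' B'" "k \<in> mor L K A'" "\<alpha> \<in> cells L (f \<odot>\<^bsub>L\<^esub> k) (\<zero>\<^bsub>L\<^esub> K B')"
    using assms(1) unfolding is_two_kernel_def by blast
  then show thesis using that mor_unique[OF assms(2)] by simp
qed

lemma two_cokernelE:
  assumes "is_two_cokernel L f c \<alpha>" "f \<in> mor L A B"
  obtains C where "c \<in> mor L B C" "\<alpha> \<in> cells L (c \<odot>\<^bsub>L\<^esub> f) (\<zero>\<^bsub>L\<^esub> A C)"
proof -
  obtain A' B' C where "f \<in> mor L A' B'" "c \<in> mor L B' C" "\<alpha> \<in> cells L (c \<odot>\<^bsub>L\<^esub> f) (\<zero>\<^bsub>L\<^esub> A' C)"
    using assms(1) unfolding is_two_cokernel_def by blast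
  then show thesis using that mor_unique[OF assms(2)] by simp
qed

text \<open>The definition hides its objects behind existential quantifiers. Since
  \<open>src\<close> and \<open>trg\<close> are functions, \<open>mor_unique\<close> identifies them
  with the given ones, so the universal property can be used at known types.\<close>

lemma two_kernelD:
  assumes "is_two_kernel L f k \<alpha>" "f \<in> mor L A B" "k \<in> mor L K A"
  shows "\<alpha> \<in> cells L (f \<odot>\<^bsub>L\<^esub> k) (\<zero>\<^bsub>L\<^esub> K B)"
    and "\<forall>Z \<in> Ob L. \<forall>z \<in> mor L Z A. \<forall>\<beta> \<in> cells L (f \<odot>\<^bsub>L\<^esub> z) (\<zero>\<^bsub>L\<^esub> Z B).
        \<exists>u \<in> mor L Z K. \<exists>\<gamma> \<in> cells L z (k \<odot>\<^bsub>L\<^esub> u). \<beta> = (\<alpha> \<lhd>\<^bsub>L\<^esub> u) \<bullet>\<^bsub>L\<^esub> (f \<rhd>\<^bsub>L\<^esub> \<gamma>)"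
    and "\<forall>Z \<in> Ob L. \<forall>u \<in> mor L Z K. \<forall>v \<in> mor L Z K. \<forall>l \<in> cells L (k \<odot>\<^bsub>L\<^esub> u) (k \<odot>\<^bsub>L\<^esub> v).
        (\<alpha> \<lhd>\<^bsub>L\<^esub> v) \<bullet>\<^bsub>L\<^esub> (f \<rhd>\<^bsub>L\<^esub> l) = \<alpha> \<lhd>\<^bsub>L\<^esub> u \<longrightarrow> (\<exists>!\<mu>. \<mu> \<in> cells L u v \<and> k \<rhd>\<^bsub>L\<^esub> \<mu> = l)"
proof -
  obtain A' B' K' where *: "f \<in> mor L A' B'" "k \<in> mor L K' A'"
    "\<alpha> \<in> cells L (f \<odot>\<^bsub>L\<^esub> k) (\<zero>\<^bsub>L\<^esub> K' B')"
    "\<forall>Z \<in> Ob L. \<forall>z \<in> mor L Z A'. \<forall>\<beta> \<in> cells L (f \<odot>\<^bsub>L\<^esub> z) (\<zero>\<^bsub>L\<^esub> Z B').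
        \<exists>u \<in> mor L Z K'. \<exists>\<gamma> \<in> cells L z (k \<odot>\<^bsub>L\<^esub> u). \<beta> = (\<alpha> \<lhd>\<^bsub>L\<^esub> u) \<bullet>\<^bsub>L\<^esub> (f \<rhd>\<^bsub>L\<^esub> \<gamma>)"
    "\<forall>Z \<in> Ob L. \<forall>u \<in> mor L Z K'. \<forall>v \<in> mor L Z K'. \<forall>l \<in> cells L (k \<odot>\<^bsub>L\<^esub> u) (k \<odot>\<^bsub>L\<^esub> v).
        (\<alpha> \<lhd>\<^bsub>L\<^esub> v) \<bullet>\<^bsub>L\<^esub> (f \<rhd>\<^bsub>L\<^esub> l) = \<alpha> \<lhd>\<^bsub>L\<^esub> u \<longrightarrow> (\<exists>!\<mu>. \<mu> \<in> cells L u v \<and> k \<rhd>\<^bsub>L\<^esub> \<mu> = l)"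
    using assms(1) unfolding is_two_kernel_def by (elim exE conjE) (rule that)
  note eqs = mor_unique[OF assms(2) *(1)] mor_unique[OF assms(3) *(2)]
  show "\<alpha> \<in> cells L (f \<odot>\<^bsub>L\<^esub> k) (\<zero>\<^bsub>L\<^esub> K B)"
    using *(3) unfolding eqs .
  show "\<forall>Z \<in> Ob L. \<forall>z \<in> mor L Z A. \<forall>\<beta> \<in> cells L (f \<odot>\<^bsub>L\<^esub> z) (\<zero>\<^bsub>L\<^esub> Z B).
        \<exists>u \<in> mor L Z K. \<exists>\<gamma> \<in> cells L z (k \<odot>\<^bsub>L\<^esub> u). \<beta> = (\<alpha> \<lhd>\<^bsub>L\<^esub> u) \<bullet>\<^bsub>L\<^esub> (f \<rhd>\<^bsub>L\<^esub> \<gamma>)"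
    using *(4) unfolding eqs .
  show "\<forall>Z \<in> Ob L. \<forall>u \<in> mor L Z K. \<forall>v \<in> mor L Z K. \<forall>l \<in> cells L (k \<odot>\<^bsub>L\<^esub> u) (k \<odot>\<^bsub>L\<^esub> v).
        (\<alpha> \<lhd>\<^bsub>L\<^esub> v) \<bullet>\<^bsub>L\<^esub> (f \<rhd>\<^bsub>L\<^esub> l) = \<alpha> \<lhd>\<^bsub>L\<^esub> u \<longrightarrow> (\<exists>!\<mu>. \<mu> \<in> cells L u v \<and> k \<rhd>\<^bsub>L\<^esub> \<mu> = l)"
    using *(5) unfolding eqs .
qed

lemma two_cokernelD:
  assumes "is_two_cokernel L f c \<alpha>" "f \<in> mor L A B" "c \<in> mor L B C"
  shows "\<alpha> \<in> cells L (c \<odot>\<^bsub>L\<^esub> f) (\<zero>\<^bsub>L\<^esub> A C)"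
    and "\<forall>Z \<in> Ob L. \<forall>z \<in> mor L B Z. \<forall>\<beta> \<in> cells L (z \<odot>\<^bsub>L\<^esub> f) (\<zero>\<^bsub>L\<^esub> A Z).
        \<exists>u \<in> mor L C Z. \<exists>\<gamma> \<in> cells L z (u \<odot>\<^bsub>L\<^esub> c). \<beta> = (u \<rhd>\<^bsub>L\<^esub> \<alpha>) \<bullet>\<^bsub>L\<^esub> (\<gamma> \<lhd>\<^bsub>L\<^esub> f)"
    and "\<forall>Z \<in> Ob L. \<forall>u \<in> mor L C Z. \<forall>v \<in> mor L C Z. \<forall>l \<in> cells L (u \<odot>\<^bsub>L\<^esub> c) (v \<odot>\<^bsub>L\<^esub> c).
        (v \<rhd>\<^bsub>L\<^esub> \<alpha>) \<bullet>\<^bsub>L\<^esub> (l \<lhd>\<^bsub>L\<^esub> f) = u \<rhd>\<^bsub>L\<^esub> \<alpha> \<longrightarrow> (\<exists>!\<mu>. \<mu> \<in> cells L u v \<and> \<mu> \<lhd>\<^bsub>L\<^esub> c = l)"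
proof -
  obtain A' B' C' where *: "f \<in> mor L A' B'" "c \<in> mor L B' C'"
    "\<alpha> \<in> cells L (c \<odot>\<^bsub>L\<^esub> f) (\<zero>\<^bsub>L\<^esub> A' C')"
    "\<forall>Z \<in> Ob L. \<forall>z \<in> mor L B' Z. \<forall>\<beta> \<in> cells L (z \<odot>\<^bsub>L\<^esub> f) (\<zero>\<^bsub>L\<^esub> A' Z).
        \<exists>u \<in> mor L C' Z. \<exists>\<gamma> \<in> cells L z (u \<odot>\<^bsub>L\<^esub> c). \<beta> = (u \<rhd>\<^bsub>L\<^esub> \<alpha>) \<bullet>\<^bsub>L\<^esub> (\<gamma> \<lhd>\<^bsub>L\<^esub> f)"
    "\<forall>Z \<in> Ob L. \<forall>u \<in> mor L C' Z. \<forall>v \<in> mor L C' Z. \<forall>l \<in> cells L (u \<odot>\<^bsub>L\<^esub> c) (v \<odot>\<^bsub>L\<^esub> c).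
        (v \<rhd>\<^bsub>L\<^esub> \<alpha>) \<bullet>\<^bsub>L\<^esub> (l \<lhd>\<^bsub>L\<^esub> f) = u \<rhd>\<^bsub>L\<^esub> \<alpha> \<longrightarrow> (\<exists>!\<mu>. \<mu> \<in> cells L u v \<and> \<mu> \<lhd>\<^bsub>L\<^esub> c = l)"
    using assms(1) unfolding is_two_cokernel_def by (elim exE conjE) (rule that)
  note eqs = mor_unique[OF assms(2) *(1)] mor_unique[OF assms(3) *(2)]
  show "\<alpha> \<in> cells L (c \<odot>\<^bsub>L\<^esub> f) (\<zero>\<^bsub>L\<^esub> A C)"
    using *(3) unfolding eqs .
  show "\<forall>Z \<in> Ob L. \<forall>z \<in> mor L B Z. \<forall>\<beta> \<in> cells L (z \<odot>\<^bsub>L\<^esub> f) (\<zero>\<^bsub>L\<^esub> A Z).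
        \<exists>u \<in> mor L C Z. \<exists>\<gamma> \<in> cells L z (u \<odot>\<^bsub>L\<^esub> c). \<beta> = (u \<rhd>\<^bsub>L\<^esub> \<alpha>) \<bullet>\<^bsub>L\<^esub> (\<gamma> \<lhd>\<^bsub>L\<^esub> f)"
    using *(4) unfolding eqs .
  show "\<forall>Z \<in> Ob L. \<forall>u \<in> mor L C Z. \<forall>v \<in> mor L C Z. \<forall>l \<in> cells L (u \<odot>\<^bsub>L\<^esub> c) (v \<odot>\<^bsub>L\<^esub> c).
        (v \<rhd>\<^bsub>L\<^esub> \<alpha>) \<bullet>\<^bsub>L\<^esub> (l \<lhd>\<^bsub>L\<^esub> f) = u \<rhd>\<^bsub>L\<^esub> \<alpha> \<longrightarrow> (\<exists>!\<mu>. \<mu> \<in> cells L u v \<and> \<mu> \<lhd>\<^bsub>L\<^esub> c = l)"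
    using *(5) unfolding eqs .
qed

section \<open>Invertible 2-cells, (co)faithfulness and weak closedness\<close>

context locally_SCG_category
begin

lemma zero_mor: "A \<in> Ob L \<Longrightarrow> B \<in> Ob L \<Longrightarrow> \<zero> A B \<in> mor L A B"
  using symmetric_monoidal_category.unt_obj[of "hom_scg L A B"] hom_SCG[of A B]
  by (simp add: hom_scg_def symmetric_categorical_group_def)

lemma cell_inverse:
  assumes \<mu>: "\<mu> \<in> cells L f g"
  obtains \<nu> where "\<nu> \<in> cells L g f" "\<nu> \<bullet> \<mu> = id2 L f" "\<mu> \<bullet> \<nu> = id2 L g"
proof -
  obtain A B where fg: "f \<in> mor L A B" "g \<in> mor L A B"
    by (rule cells_domE[OF \<mu>])
  then have "groupoid (hom_scg L A B)"
    using hom_SCG[of A B] by (simp add: mor_Ob symmetric_categorical_group_def)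
  from groupoid.all_iso[OF this, of f g] fg \<mu> show thesis
    using that by (auto simp: hom_scg_def iso_arr_def)
qed

lemma iso_morI: "\<mu> \<in> cells L f g \<Longrightarrow> iso_mor L f g"
  by (rule cell_inverse[of \<mu> f g], assumption)
    (auto simp: iso_mor_def isomorphic_def iso_arr_def hom_cat_def)

text \<open>Every 2-cell of the form \<open>k \<rhd> \<mu>\<close> is compatible with
  \<open>\<alpha>\<close>, because exchanging \<open>\<mu>\<close> with \<open>\<alpha>\<close>
  replaces it by a whiskering with zero. Uniqueness of lifts along \<open>k\<close> then gives
  faithfulness.\<close>

lemma two_kernel_faithful:
  assumes "is_two_kernel L f k \<alpha>"
  shows "faithful L k"
proof -
  obtain A B where f: "f \<in> mor L A B"
    using assms by (auto simp: is_two_kernel_def)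
  obtain K where k: "k \<in> mor L K A" and \<alpha>: "\<alpha> \<in> cells L (f \<odot> k) (\<zero> K B)"
    by (rule two_kernelE[OF assms f])
  have "\<mu> = \<nu>"
    if X: "X \<in> Ob L" and g: "g \<in> mor L X K" and h: "h \<in> mor L X K"
      and \<mu>: "\<mu> \<in> cells L g h" and \<nu>: "\<nu> \<in> cells L g h" and eq: "k \<rhd> \<mu> = k \<rhd> \<nu>" for X g h \<mu> \<nu>
  proof -
    have "(\<alpha> \<lhd> h) \<bullet> (f \<rhd> (k \<rhd> \<mu>)) = (\<alpha> \<lhd> h) \<bullet> ((f \<odot> k) \<rhd> \<mu>)"
      by (simp add: lwhisker_comp1[OF g k f \<mu>])
    also have "\<dots> = (\<zero> K B \<rhd> \<mu>) \<bullet> (\<alpha> \<lhd> g)"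
      by (rule whisker_exchange[OF g comp1_mor[OF k f] \<mu> \<alpha>])
    also have "\<dots> = \<alpha> \<lhd> g"
      using rwhisker_cells[OF g comp1_mor[OF k f] \<alpha>]
      by (simp add: zero_whisker[OF g h \<mu> mor_Ob(2)[OF f]] zero_comp[OF mor_Ob(2)[OF f] g]
          id2_vcomp)
    finally have "\<exists>!\<xi>. \<xi> \<in> cells L g h \<and> k \<rhd> \<xi> = k \<rhd> \<mu>"
      using two_kernelD(3)[OF assms f k] X g h lwhisker_cells[OF k g \<mu>] by blast
    then show ?thesis using \<mu> \<nu> eq by metis
  qed
  then show ?thesis
    using k by (auto simp: faithful_def mor_def)
qed

lemma two_cokernel_cofaithful:
  assumes "is_two_cokernel L f c \<alpha>"
  shows "cofaithful L c"
proof -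
  obtain A B where f: "f \<in> mor L A B"
    using assms by (auto simp: is_two_cokernel_def)
  obtain C where c: "c \<in> mor L B C" and \<alpha>: "\<alpha> \<in> cells L (c \<odot> f) (\<zero> A C)"
    by (rule two_cokernelE[OF assms f])
  have "\<mu> = \<nu>"
    if X: "X \<in> Ob L" and g: "g \<in> mor L C X" and h: "h \<in> mor L C X"
      and \<mu>: "\<mu> \<in> cells L g h" and \<nu>: "\<nu> \<in> cells L g h" and eq: "\<mu> \<lhd> c = \<nu> \<lhd> c" for X g h \<mu> \<nu>
  proof -
    have "(h \<rhd> \<alpha>) \<bullet> ((\<mu> \<lhd> c) \<lhd> f) = (h \<rhd> \<alpha>) \<bullet> (\<mu> \<lhd> (c \<odot> f))"
      by (simp add: rwhisker_comp1[OF f c g \<mu>])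
    also have "\<dots> = (\<mu> \<lhd> \<zero> A C) \<bullet> (g \<rhd> \<alpha>)"
      by (rule whisker_exchange[OF comp1_mor[OF f c] g \<alpha> \<mu>, symmetric])
    also have "\<dots> = g \<rhd> \<alpha>"
      using lwhisker_cells[OF g comp1_mor[OF f c] \<alpha>]
      by (simp add: whisker_zero[OF g h \<mu> mor_Ob(1)[OF f]] comp_zero[OF mor_Ob(1)[OF f] g]
          id2_vcomp)
    finally have "\<exists>!\<xi>. \<xi> \<in> cells L g h \<and> \<xi> \<lhd> c = \<mu> \<lhd> c"
      using two_cokernelD(3)[OF assms f c] X g h rwhisker_cells[OF c g \<mu>] by blast
    then show ?thesis using \<mu> \<nu> eq by metis
  qed
  then show ?thesis
    using c by (auto simp: cofaithful_def mor_def)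
qed

lemma cofaithful_comp1:
  assumes e: "e \<in> mor L A B" and q: "q \<in> mor L B C" and ce: "cofaithful L e" and cq: "cofaithful L q"
  shows "cofaithful L (q \<odot> e)"
proof -
  have qe: "q \<odot> e \<in> mor L A C" by (rule comp1_mor[OF e q])
  have "\<mu> = \<nu>"
    if X: "X \<in> Ob L" and g: "g \<in> mor L C X" and h: "h \<in> mor L C X"
      and \<mu>: "\<mu> \<in> cells L g h" and \<nu>: "\<nu> \<in> cells L g h"
      and eq: "\<mu> \<lhd> (q \<odot> e) = \<nu> \<lhd> (q \<odot> e)" for X g h \<mu> \<nu>
  proof -
    have te: "trg L e = B" and tq: "trg L q = C" using e q by (simp_all add: mor_def)
    have "(\<mu> \<lhd> q) \<lhd> e = (\<nu> \<lhd> q) \<lhd> e"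
      using eq by (simp add: rwhisker_comp1[OF e q g \<mu>] rwhisker_comp1[OF e q g \<nu>])
    then have "\<mu> \<lhd> q = \<nu> \<lhd> q"
      using ce[unfolded cofaithful_def te] X comp1_mor[OF q g] comp1_mor[OF q h]
        rwhisker_cells[OF q g \<mu>] rwhisker_cells[OF q g \<nu>] by blast
    then show ?thesis
      using cq[unfolded cofaithful_def tq] X g h \<mu> \<nu> by blast
  qed
  then show ?thesis
    using qe by (auto simp: cofaithful_def mor_def)
qed

text \<open>Since \<open>\<alpha>\<close> whiskered with a zero morphism is an identity, the
  equation assumed of \<open>\<delta>\<close> is exactly the compatibility needed to lift it to a
  2-cell into the zero morphism. The second condition is an instance of faithfulness of
  \<open>k\<close>; the other half is dual.\<close>

lemma zero_ideal_weakly_closed: "zero_ideal_weakly_closed L"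
  unfolding zero_ideal_weakly_closed_def
proof (intro conjI allI impI ballI)
  fix A B K f k \<alpha> S
  assume f: "f \<in> mor L A B" and k: "k \<in> mor L K A" and ker: "is_two_kernel L f k \<alpha>" and S: "S \<in> Ob L"
  note D = two_kernelD[OF ker f k]
  have ob: "A \<in> Ob L" "B \<in> Ob L" "K \<in> Ob L" using f k by (simp_all add: mor_Ob)
  have z: "\<zero> S K \<in> mor L S K" by (simp add: zero_mor S ob)
  have k0: "k \<odot> \<zero> S K = \<zero> S A" by (rule comp_zero[OF S k])
  have \<alpha>0: "\<alpha> \<lhd> \<zero> S K = id2 L (\<zero> S B)"
    by (rule whisker_zero[OF comp1_mor[OF k f] _ D(1) S]) (simp add: zero_mor ob)
  {
    fix s \<delta> assume s: "s \<in> mor L S K" and \<delta>: "\<delta> \<in> cells L (k \<odot> s) (\<zero> S A)" and eq: "f \<rhd> \<delta> = \<alpha> \<lhd> s"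
    have "f \<rhd> \<delta> \<in> cells L (f \<odot> (k \<odot> s)) (\<zero> S B)"
      using lwhisker_cells[OF f comp1_mor[OF s k] \<delta>] by (simp add: comp_zero[OF S f])
    then have "(\<alpha> \<lhd> \<zero> S K) \<bullet> (f \<rhd> \<delta>) = \<alpha> \<lhd> s"
      by (simp add: \<alpha>0 id2_vcomp eq)
    then have "\<exists>!\<psi>. \<psi> \<in> cells L s (\<zero> S K) \<and> k \<rhd> \<psi> = \<delta>"
      using D(3)[rule_format, OF S s z, unfolded k0, OF \<delta>] by blast
    then show "\<exists>\<psi> \<in> cells L s (\<zero> S K). k \<rhd> \<psi> = \<delta>" by blast
  next
    fix \<mu> assume \<mu>: "\<mu> \<in> cells L (\<zero> S K) (\<zero> S K)" and eq: "k \<rhd> \<mu> = id2 L (\<zero> S A)"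
    have "k \<rhd> \<mu> = k \<rhd> id2 L (\<zero> S K)"
      by (simp add: eq lwhisker_id2[OF k z] k0)
    moreover have "src L k = K" using k by (simp add: mor_def)
    ultimately show "\<mu> = id2 L (\<zero> S K)"
      using two_kernel_faithful[OF ker] S z \<mu> id2_cells[OF z] unfolding faithful_def by blast
  }
next
  fix A B C f c \<alpha> S
  assume f: "f \<in> mor L A B" and c: "c \<in> mor L B C" and cok: "is_two_cokernel L f c \<alpha>" and S: "S \<in> Ob L"
  note D = two_cokernelD[OF cok f c]
  have ob: "A \<in> Ob L" "B \<in> Ob L" "C \<in> Ob L" using f c by (simp_all add: mor_Ob)
  have z: "\<zero> C S \<in> mor L C S" by (simp add: zero_mor S ob)
  have c0: "\<zero> C S \<odot> c = \<zero> B S" by (rule zero_comp[OF S c])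
  have \<alpha>0: "\<zero> C S \<rhd> \<alpha> = id2 L (\<zero> A S)"
    by (rule zero_whisker[OF comp1_mor[OF f c] _ D(1) S]) (simp add: zero_mor ob)
  {
    fix s \<delta> assume s: "s \<in> mor L C S" and \<delta>: "\<delta> \<in> cells L (s \<odot> c) (\<zero> B S)" and eq: "\<delta> \<lhd> f = s \<rhd> \<alpha>"
    have "\<delta> \<lhd> f \<in> cells L ((s \<odot> c) \<odot> f) (\<zero> A S)"
      using rwhisker_cells[OF f comp1_mor[OF c s] \<delta>] by (simp add: zero_comp[OF S f])
    then have "(\<zero> C S \<rhd> \<alpha>) \<bullet> (\<delta> \<lhd> f) = s \<rhd> \<alpha>"
      by (simp add: \<alpha>0 id2_vcomp eq)
    then have "\<exists>!\<psi>. \<psi> \<in> cells L s (\<zero> C S) \<and> \<psi> \<lhd> c = \<delta>"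
      using D(3)[rule_format, OF S s z, unfolded c0, OF \<delta>] by blast
    then show "\<exists>\<psi> \<in> cells L s (\<zero> C S). \<psi> \<lhd> c = \<delta>" by blast
  next
    fix \<mu> assume \<mu>: "\<mu> \<in> cells L (\<zero> C S) (\<zero> C S)" and eq: "\<mu> \<lhd> c = id2 L (\<zero> B S)"
    have "\<mu> \<lhd> c = id2 L (\<zero> C S) \<lhd> c"
      by (simp add: eq rwhisker_id2[OF c z] c0)
    moreover have "trg L c = C" using c by (simp add: mor_def)
    ultimately show "\<mu> = id2 L (\<zero> C S)"
      using two_cokernel_cofaithful[OF cok] S z \<mu> id2_cells[OF z] unfolding cofaithful_def by blast
  }
qed

section \<open>Detecting faithfulness at zero morphisms\<close>

text \<open>Tensoring with an inverse of \<open>g\<close> translates automorphisms of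
  \<open>g\<close> to automorphisms of zero, and this is compatible with \<open>m\<close> because
  postcomposition is monoidal.\<close>

lemma faithful_if_reflects_zero:
  assumes m: "m \<in> mor L B C"
    and refl: "\<And>X \<mu>. X \<in> Ob L \<Longrightarrow> \<mu> \<in> cells L (\<zero> X B) (\<zero> X B) \<Longrightarrow> m \<rhd> \<mu> = id2 L (\<zero> X C) \<Longrightarrow>
      \<mu> = id2 L (\<zero> X B)"
  shows "faithful L m"
proof -
  have endo: "a = id2 L g"
    if g: "g \<in> mor L X B" and a: "a \<in> cells L g g" and ma: "m \<rhd> a = id2 L (m \<odot> g)" for X g a
  proof -
    have X: "X \<in> Ob L" and B: "B \<in> Ob L" using g by (simp_all add: mor_Ob)
    interpret H: symmetric_categorical_group "hom_scg L X B" by (rule hom_SCG[OF X B])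
    interpret F: symmetric_monoidal_functor "hom_scg L X B" "hom_scg L X C"
      "\<lambda>g. m \<odot> g" "\<lambda>\<mu>. m \<rhd> \<mu>" "lcon L m" "id2 L (\<zero> X C)"
      by (rule postcomp_monoidal[OF X m])
    obtain h where h: "h \<in> mor L X B" and "isomorphic (hom_scg L X B) (mtens L g h) (\<zero> X B)"
      using H.ex_inverse[of g] g by (auto simp: hom_scg_def)
    then obtain i j where i: "i \<in> cells L (mtens L g h) (\<zero> X B)" and j: "j \<in> cells L (\<zero> X B) (mtens L g h)"
      and ji: "j \<bullet> i = id2 L (mtens L g h)" and ij: "i \<bullet> j = id2 L (\<zero> X B)"
      by (auto simp: hom_scg_def isomorphic_def iso_arr_def)
    have h1: "id2 L h \<in> cells L h h" by (rule id2_cells[OF h])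
    have gh: "mtens L g h \<in> mor L X B"
      using H.tens_obj[of g h] g h by (simp add: hom_scg_def)
    \<comment> \<open>The translate of \<open>a\<close> by the inverse \<open>h\<close>; it lives on
      an object that \<open>i\<close> identifies with \<open>\<zero> X B\<close>.\<close>
    define b where "b = ctens L a (id2 L h)"
    have b: "b \<in> cells L (mtens L g h) (mtens L g h)"
      using H.atens_arr[of g g h h a "id2 L h"] g h a h1 by (simp add: hom_scg_def b_def)
    have mg: "m \<odot> g \<in> mor L X C" "m \<odot> h \<in> mor L X C" "m \<odot> mtens L g h \<in> mor L X C"
      by (rule comp1_mor[OF _ m], fact)+
    have lc: "lcon L m g h \<in> iso_arr (hom_scg L X C) (mtens L (m \<odot> g) (m \<odot> h)) (m \<odot> mtens L g h)"
      using F.phi_iso[of g h] g h by (simp add: hom_scg_def)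
    then have lcc: "lcon L m g h \<in> cells L (mtens L (m \<odot> g) (m \<odot> h)) (m \<odot> mtens L g h)"
      by (simp add: iso_arr_def hom_scg_def)
    \<comment> \<open>The constraint \<open>lcon\<close> conjugates \<open>m \<rhd> b\<close> to a
      tensor product of two identities, so \<open>m \<rhd> b\<close> is an identity too.\<close>
    have "(m \<rhd> b) \<bullet> lcon L m g h = lcon L m g h \<bullet> ctens L (m \<rhd> a) (m \<rhd> id2 L h)"
      using F.phi_nat[of g g h h a "id2 L h"] g h a h1 by (simp add: hom_scg_def b_def)
    also have "ctens L (m \<rhd> a) (m \<rhd> id2 L h) = id2 L (mtens L (m \<odot> g) (m \<odot> h))"
      using F.D.atens_idn[of "m \<odot> g" "m \<odot> h"] mg
      by (simp add: hom_scg_def ma lwhisker_id2[OF m h])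
    also have "lcon L m g h \<bullet> \<dots> = id2 L (m \<odot> mtens L g h) \<bullet> lcon L m g h"
      by (simp add: vcomp_id2[OF lcc] id2_vcomp[OF lcc])
    finally have "m \<rhd> b = id2 L (m \<odot> mtens L g h)"
      using F.D.iso_cancel_right[OF _ _ _ lc, of "m \<odot> mtens L g h" "m \<rhd> b" "id2 L (m \<odot> mtens L g h)"]
        mg F.D.tens_obj[of "m \<odot> g" "m \<odot> h"] lwhisker_cells[OF m gh b] id2_cells[OF mg(3)]
      by (simp add: hom_scg_def)
    \<comment> \<open>Conjugating \<open>b\<close> by \<open>i\<close> and \<open>j\<close> gives an
      automorphism of zero, where \<open>refl\<close> applies; afterwards the conjugation is
      undone.\<close>
    then have "m \<rhd> ((i \<bullet> b) \<bullet> j) = m \<rhd> (i \<bullet> j)"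
      using vcomp_id2[OF lwhisker_cells[OF m gh i]]
      by (simp add: lwhisker_vcomp[OF m zero_mor[OF X B] j vcomp_cells[OF i b]]
          lwhisker_vcomp[OF m gh b i] lwhisker_vcomp[OF m zero_mor[OF X B] j i])
    also have "\<dots> = id2 L (\<zero> X C)"
      by (simp add: ij lwhisker_id2[OF m zero_mor[OF X B]] comp_zero[OF X m])
    finally have "(i \<bullet> b) \<bullet> j = id2 L (\<zero> X B)"
      by (rule refl[OF X vcomp_cells[OF vcomp_cells[OF i b] j]])
    then have "((i \<bullet> b) \<bullet> j) \<bullet> i = i"
      by (simp add: id2_vcomp[OF i])
    then have "i \<bullet> b = i"
      by (simp add: vcomp_assoc[OF vcomp_cells[OF i b] j i] ji vcomp_id2[OF vcomp_cells[OF i b]])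
    then have "(j \<bullet> i) \<bullet> b = j \<bullet> i"
      by (simp add: vcomp_assoc[OF j i b])
    then have "b = id2 L (mtens L g h)"
      by (simp add: ji id2_vcomp[OF b])
    then show ?thesis
      using H.atens_idn_reflects_idn[of g h a] g h a by (simp add: hom_scg_def b_def)
  qed
  \<comment> \<open>Two parallel 2-cells with the same image differ by the automorphism
    \<open>\<nu>' \<bullet> \<mu>\<close> of \<open>g\<close>, which \<open>m\<close> sends to an
    identity.\<close>
  have "\<mu> = \<nu>"
    if g: "g \<in> mor L X B" and \<mu>: "\<mu> \<in> cells L g h" and \<nu>: "\<nu> \<in> cells L g h" and eq: "m \<rhd> \<mu> = m \<rhd> \<nu>"
    for X g h \<mu> \<nu>
  proof -
    obtain \<nu>' where \<nu>': "\<nu>' \<in> cells L h g" "\<nu>' \<bullet> \<nu> = id2 L g" "\<nu> \<bullet> \<nu>' = id2 L h"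
      by (rule cell_inverse[OF \<nu>])
    have "m \<rhd> (\<nu>' \<bullet> \<mu>) = m \<rhd> (\<nu>' \<bullet> \<nu>)"
      by (simp add: lwhisker_vcomp[OF m g \<mu> \<nu>'(1)] lwhisker_vcomp[OF m g \<nu> \<nu>'(1)] eq)
    then have "\<nu>' \<bullet> \<mu> = id2 L g"
      by (intro endo[OF g vcomp_cells[OF \<nu>'(1) \<mu>]]) (simp add: \<nu>' lwhisker_id2[OF m g])
    then have "\<nu> \<bullet> (\<nu>' \<bullet> \<mu>) = \<nu>"
      by (simp add: vcomp_id2[OF \<nu>])
    then show ?thesis
      by (simp add: vcomp_assoc[OF \<nu> \<nu>'(1) \<mu>, symmetric] \<nu>' id2_vcomp[OF \<mu>])
  qed
  then show ?thesis
    using m unfolding faithful_def by (auto simp: mor_def)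
qed

section \<open>Factorization through the coimage\<close>

text \<open>
  Applied below with \<open>a = q \<odot> e\<close>, once to \<open>g = f\<close> and once to \<open>g = e\<close>: it transports a nullity
  \<open>\<kappa>\<close> of \<open>g \<odot> k\<close> along the endomorphism \<open>t \<odot> w\<close> of the 2-kernel object.
\<close>

lemma paste_factorizations:
  assumes k: "k \<in> mor L K A" and l: "l \<in> mor L M A" and a: "a \<in> mor L A C"
    and g: "g \<in> mor L A D" and n: "n \<in> mor L C D"
    and t: "t \<in> mor L M K" and w: "w \<in> mor L K M"
    and \<kappa>: "\<kappa> \<in> cells L (g \<odot> k) (\<zero> K D)" and \<tau>: "\<tau> \<in> cells L (a \<odot> l) (\<zero> M C)"
    and \<Phi>: "\<Phi> \<in> cells L g (n \<odot> a)"
    and \<zeta>: "\<zeta> \<in> cells L l (k \<odot> t)" and \<omega>: "\<omega> \<in> cells L k (l \<odot> w)"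
    and eq: "(n \<rhd> \<tau>) \<bullet> (\<Phi> \<lhd> l) = (\<kappa> \<lhd> t) \<bullet> (g \<rhd> \<zeta>)"
  shows "(\<kappa> \<lhd> (t \<odot> w)) \<bullet> (g \<rhd> ((\<zeta> \<lhd> w) \<bullet> \<omega>)) = (n \<rhd> ((\<tau> \<lhd> w) \<bullet> (a \<rhd> \<omega>))) \<bullet> (\<Phi> \<lhd> k)"
proof -
  have ob: "C \<in> Ob L" "D \<in> Ob L" "K \<in> Ob L" "M \<in> Ob L"
    using n t by (simp_all add: mor_Ob)
  note gk = comp1_mor[OF k g] and lw = comp1_mor[OF w l] and gl = comp1_mor[OF l g]
    and al = comp1_mor[OF l a] and na = comp1_mor[OF a n]
  have kt: "\<zeta> \<lhd> w \<in> cells L (l \<odot> w) ((k \<odot> t) \<odot> w)"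
    by (rule rwhisker_cells[OF w l \<zeta>])
  have c1: "g \<rhd> \<zeta> \<in> cells L (g \<odot> l) ((g \<odot> k) \<odot> t)"
    using lwhisker_cells[OF g l \<zeta>] by (simp add: comp1_assoc[OF t k g])
  have c2: "\<kappa> \<lhd> t \<in> cells L ((g \<odot> k) \<odot> t) (\<zero> M D)"
    using rwhisker_cells[OF t gk \<kappa>] by (simp add: zero_comp[OF ob(2) t])
  have c3: "g \<rhd> \<omega> \<in> cells L (g \<odot> k) ((g \<odot> l) \<odot> w)"
    using lwhisker_cells[OF g k \<omega>] by (simp add: comp1_assoc[OF w l g])
  have c4: "\<Phi> \<lhd> l \<in> cells L (g \<odot> l) (n \<odot> (a \<odot> l))"
    using rwhisker_cells[OF l g \<Phi>] by (simp add: comp1_assoc[OF l a n])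
  have c5: "n \<rhd> \<tau> \<in> cells L (n \<odot> (a \<odot> l)) (\<zero> M D)"
    using lwhisker_cells[OF n al \<tau>] by (simp add: comp_zero[OF ob(4) n])
  have c6: "\<Phi> \<lhd> k \<in> cells L (g \<odot> k) (n \<odot> (a \<odot> k))"
    using rwhisker_cells[OF k g \<Phi>] by (simp add: comp1_assoc[OF k a n])
  have c7: "a \<rhd> \<omega> \<in> cells L (a \<odot> k) ((a \<odot> l) \<odot> w)"
    using lwhisker_cells[OF a k \<omega>] by (simp add: comp1_assoc[OF w l a])
  have c8: "\<tau> \<lhd> w \<in> cells L ((a \<odot> l) \<odot> w) (\<zero> K C)"
    using rwhisker_cells[OF w al \<tau>] by (simp add: zero_comp[OF ob(1) w])
  have c9: "n \<rhd> (a \<rhd> \<omega>) \<in> cells L (n \<odot> (a \<odot> k)) (n \<odot> ((a \<odot> l) \<odot> w))"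
    by (rule lwhisker_cells[OF n comp1_mor[OF k a] c7])
  have c10: "(n \<rhd> \<tau>) \<lhd> w \<in> cells L (n \<odot> ((a \<odot> l) \<odot> w)) (\<zero> M D \<odot> w)"
    using rwhisker_cells[OF w comp1_mor[OF al n] c5] by (simp add: comp1_assoc[OF w al n])
  have c11: "(\<Phi> \<lhd> l) \<lhd> w \<in> cells L ((g \<odot> l) \<odot> w) (n \<odot> ((a \<odot> l) \<odot> w))"
    using rwhisker_cells[OF w gl c4] by (simp add: comp1_assoc[OF w al n])
  have "(\<kappa> \<lhd> (t \<odot> w)) \<bullet> (g \<rhd> ((\<zeta> \<lhd> w) \<bullet> \<omega>)) =
      ((\<kappa> \<lhd> t) \<lhd> w) \<bullet> (((g \<rhd> \<zeta>) \<lhd> w) \<bullet> (g \<rhd> \<omega>))"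
    by (simp add: rwhisker_comp1[OF w t gk \<kappa>] lwhisker_vcomp[OF g k \<omega> kt]
        lwhisker_rwhisker[OF w l g \<zeta>])
  also have "\<dots> = (((\<kappa> \<lhd> t) \<lhd> w) \<bullet> ((g \<rhd> \<zeta>) \<lhd> w)) \<bullet> (g \<rhd> \<omega>)"
    by (rule vcomp_assoc[symmetric, OF rwhisker_cells[OF w comp1_mor[OF t gk] c2]
          rwhisker_cells[OF w gl c1] c3])
  also have "\<dots> = (((\<kappa> \<lhd> t) \<bullet> (g \<rhd> \<zeta>)) \<lhd> w) \<bullet> (g \<rhd> \<omega>)"
    by (simp add: rwhisker_vcomp[OF w gl c1 c2])
  also have "\<dots> = (((n \<rhd> \<tau>) \<lhd> w) \<bullet> ((\<Phi> \<lhd> l) \<lhd> w)) \<bullet> (g \<rhd> \<omega>)"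
    by (simp add: eq[symmetric] rwhisker_vcomp[OF w gl c4 c5])
  also have "\<dots> = ((n \<rhd> \<tau>) \<lhd> w) \<bullet> (((\<Phi> \<lhd> l) \<lhd> w) \<bullet> (g \<rhd> \<omega>))"
    by (rule vcomp_assoc[OF c10 c11 c3])
  also have "((\<Phi> \<lhd> l) \<lhd> w) \<bullet> (g \<rhd> \<omega>) = (n \<rhd> (a \<rhd> \<omega>)) \<bullet> (\<Phi> \<lhd> k)"
    using whisker_exchange[OF k g \<omega> \<Phi>]
    by (simp add: rwhisker_comp1[OF w l g \<Phi>] lwhisker_comp1[OF k a n \<omega>])
  also have "((n \<rhd> \<tau>) \<lhd> w) \<bullet> ((n \<rhd> (a \<rhd> \<omega>)) \<bullet> (\<Phi> \<lhd> k)) =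
      (((n \<rhd> \<tau>) \<lhd> w) \<bullet> (n \<rhd> (a \<rhd> \<omega>))) \<bullet> (\<Phi> \<lhd> k)"
    by (rule vcomp_assoc[symmetric, OF c10 c9 c6])
  also have "((n \<rhd> \<tau>) \<lhd> w) \<bullet> (n \<rhd> (a \<rhd> \<omega>)) = n \<rhd> ((\<tau> \<lhd> w) \<bullet> (a \<rhd> \<omega>))"
    by (simp add: lwhisker_vcomp[OF n comp1_mor[OF k a] c7 c8] lwhisker_rwhisker[OF w al n \<tau>])
  finally show ?thesis .
qed

text \<open>The pair \<open>m\<close>, \<open>\<phi>\<close> is what the universal property of
  \<open>e\<close> yields from the nullity \<open>\<kappa>\<close> of \<open>f \<odot> k\<close>;
  \<open>\<kappa>_eq\<close> records this and is needed to compare structure 2-cells below.\<close>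

lemma reflects_zero_coimage_comparison:
  assumes kers: "has_two_kernels L" and coks: "has_two_cokernels L"
    and cof: "\<And>e. cofaithful L e \<Longrightarrow> two_cokernel_of_its_two_kernel L e"
    and f: "f \<in> mor L A B" and k: "k \<in> mor L K A" and e: "e \<in> mor L A I"
    and ker: "is_two_kernel L f k \<kappa>" and cok: "is_two_cokernel L k e \<epsilon>"
    and m: "m \<in> mor L I B" and \<phi>: "\<phi> \<in> cells L f (m \<odot> e)"
    and \<kappa>_eq: "\<kappa> = (m \<rhd> \<epsilon>) \<bullet> (\<phi> \<lhd> k)"
    and X: "X \<in> Ob L" and \<mu>: "\<mu> \<in> cells L (\<zero> X I) (\<zero> X I)" and m\<mu>: "m \<rhd> \<mu> = id2 L (\<zero> X B)"
  shows "\<mu> = id2 L (\<zero> X I)"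
proof -
  have ob: "A \<in> Ob L" "B \<in> Ob L" "K \<in> Ob L" "I \<in> Ob L"
    using f k e by (simp_all add: mor_Ob)
  note kerD = two_kernelD[OF ker f k] and cokD = two_cokernelD[OF cok k e]

  \<comment> \<open>\<open>S\<close> is the suspension of \<open>X\<close>; whiskering \<open>\<sigma>\<close> turns morphisms \<open>S \<rightarrow> I\<close> into 2-cells
    \<open>\<zero> X I \<Rightarrow> \<zero> X I\<close>.\<close>
  obtain Z where Z: "Z \<in> Ob L" and "\<forall>A \<in> Ob L.
      (\<forall>f \<in> mor L Z A. \<exists>!\<mu>. \<mu> \<in> cells L f (\<zero> Z A)) \<and>
      (\<forall>f \<in> mor L A Z. \<exists>!\<mu>. \<mu> \<in> cells L f (\<zero> A Z))"
    using ex_zero_object by (rule bexE)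
  then have Z_init: "\<exists>\<rho>. \<rho> \<in> cells L g (\<zero> Z B)" if "B \<in> Ob L" "g \<in> mor L Z B" for B g
    using that by (meson ex1_implies_ex)
  have XZ: "\<zero> X Z \<in> mor L X Z" and XI: "\<zero> X I \<in> mor L X I"
    and ZI: "\<zero> Z I \<in> mor L Z I"
    by (simp_all add: zero_mor X Z ob)
  obtain j \<sigma> where js: "is_two_cokernel L (\<zero> X Z) j \<sigma>"
    using coks XZ unfolding has_two_cokernels_def mor_def by blast
  obtain S where j: "j \<in> mor L Z S" and "\<sigma> \<in> cells L (j \<odot> \<zero> X Z) (\<zero> X S)"
    by (rule two_cokernelE[OF js XZ])
  then have \<sigma>: "\<sigma> \<in> cells L (\<zero> X S) (\<zero> X S)"
    by (simp add: comp_zero[OF X j])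
  note jsD = two_cokernelD[OF js XZ j]
  have S: "S \<in> Ob L" using j by (simp add: mor_Ob)
  have XS: "\<zero> X S \<in> mor L X S" by (simp add: zero_mor X S)
  \<comment> \<open>Read as a nullity of a composite of zero morphisms through \<open>Z\<close>,
    \<open>\<mu>\<close> is classified by some \<open>x\<close>. The correction
    \<open>\<gamma>\<close> becomes an identity when whiskered with zero, so \<open>\<mu>\<close> is
    exactly \<open>x \<rhd> \<sigma>\<close>.\<close>
  have "\<mu> \<in> cells L (\<zero> Z I \<odot> \<zero> X Z) (\<zero> X I)"
    using \<mu> by (simp add: zero_comp[OF ob(4) XZ])
  then obtain x \<gamma> where x: "x \<in> mor L S I" and \<gamma>: "\<gamma> \<in> cells L (\<zero> Z I) (x \<odot> j)"
    and "\<mu> = (x \<rhd> \<sigma>) \<bullet> (\<gamma> \<lhd> \<zero> X Z)"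
    using jsD(2)[rule_format, OF ob(4) ZI] by blast
  moreover have "x \<rhd> \<sigma> \<in> cells L (\<zero> X I) (\<zero> X I)"
    using lwhisker_cells[OF x XS \<sigma>] by (simp add: comp_zero[OF X x])
  ultimately have x\<sigma>: "x \<rhd> \<sigma> = \<mu>"
    by (simp add: whisker_zero[OF ZI comp1_mor[OF j x] \<gamma> X] vcomp_id2)

  have mx: "m \<odot> x \<in> mor L S B" and SB: "\<zero> S B \<in> mor L S B" and ZB: "\<zero> Z B \<in> mor L Z B"
    by (simp_all add: comp1_mor[OF x m] zero_mor S Z ob)
  \<comment> \<open>\<open>\<rho>\<close> exists because \<open>Z\<close> is a zero object. It lifts
    along \<open>j\<close> to a nullity \<open>\<theta>\<close> of \<open>m \<odot> x\<close>: both
    sides of the compatibility equation are identities, thanks to \<open>m\<mu>\<close>.\<close>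
  obtain \<rho> where \<rho>: "\<rho> \<in> cells L ((m \<odot> x) \<odot> j) (\<zero> Z B)"
    using Z_init[OF ob(2) comp1_mor[OF j mx]] by blast
  have "(\<zero> S B \<rhd> \<sigma>) \<bullet> (\<rho> \<lhd> \<zero> X Z) = (m \<odot> x) \<rhd> \<sigma>"
    by (simp add: zero_whisker[OF XS XS \<sigma> ob(2)] whisker_zero[OF comp1_mor[OF j mx] ZB \<rho> X]
        lwhisker_comp1[OF XS x m \<sigma>] x\<sigma> m\<mu> vcomp_id2[OF id2_cells[OF zero_mor[OF X ob(2)]]])
  moreover have "\<rho> \<in> cells L ((m \<odot> x) \<odot> j) (\<zero> S B \<odot> j)"
    using \<rho> by (simp add: zero_comp[OF ob(2) j])
  ultimately have "\<exists>!\<theta>. \<theta> \<in> cells L (m \<odot> x) (\<zero> S B) \<and> \<theta> \<lhd> j = \<rho>"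
    using jsD(3)[rule_format, OF ob(2) mx SB] by blast
  then obtain \<theta> where \<theta>: "\<theta> \<in> cells L (m \<odot> x) (\<zero> S B)" by blast

  obtain q \<chi> where qs: "is_two_cokernel L x q \<chi>"
    using coks x unfolding has_two_cokernels_def mor_def by blast
  obtain C where q: "q \<in> mor L I C" and \<chi>: "\<chi> \<in> cells L (q \<odot> x) (\<zero> S C)"
    by (rule two_cokernelE[OF qs x])
  have C: "C \<in> Ob L" using q by (simp add: mor_Ob)
  obtain n \<psi> where n: "n \<in> mor L C B" and \<psi>: "\<psi> \<in> cells L m (n \<odot> q)"
    using two_cokernelD(2)[OF qs x q, rule_format, OF ob(2) m \<theta>] by blast
  have XC: "\<zero> X C \<in> mor L X C" by (simp add: zero_mor X C)
  have q\<mu>': "(q \<odot> x) \<rhd> \<sigma> \<in> cells L (\<zero> X C) (\<zero> X C)"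
    using lwhisker_cells[OF comp1_mor[OF x q] XS \<sigma>] by (simp add: comp_zero[OF X comp1_mor[OF x q]])
  have \<chi>0: "\<chi> \<lhd> \<zero> X S = id2 L (\<zero> X C)"
    by (rule whisker_zero[OF comp1_mor[OF x q] zero_mor[OF S C] \<chi> X])
  \<comment> \<open>Exchange \<open>\<sigma>\<close> with the nullity \<open>\<chi>\<close>; every
    factor other than this one is then an identity.\<close>
  have "(q \<odot> x) \<rhd> \<sigma> = id2 L (\<zero> X C)"
    using whisker_exchange[OF XS comp1_mor[OF x q] \<sigma> \<chi>]
    by (simp add: \<chi>0 id2_vcomp[OF q\<mu>'] zero_whisker[OF XS XS \<sigma> C] vcomp_id2[OF id2_cells[OF XC]])
  then have q\<mu>: "q \<rhd> \<mu> = id2 L (\<zero> X C)"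
    by (simp add: lwhisker_comp1[OF XS x q \<sigma>] x\<sigma>)

  define a where "a = q \<odot> e"
  have a: "a \<in> mor L A C" unfolding a_def by (rule comp1_mor[OF e q])
  have "cofaithful L a"
    unfolding a_def using e q two_cokernel_cofaithful[OF cok] two_cokernel_cofaithful[OF qs]
    by (rule cofaithful_comp1)
  then have a_cok: "two_cokernel_of_its_two_kernel L a" by (rule cof)
  obtain l \<tau> where ls: "is_two_kernel L a l \<tau>"
    using kers a unfolding has_two_kernels_def mor_def by blast
  obtain M where l: "l \<in> mor L M A" and \<tau>: "\<tau> \<in> cells L (a \<odot> l) (\<zero> M C)"
    by (rule two_kernelE[OF ls a])
  have M: "M \<in> Ob L" using l by (simp add: mor_Ob)
  have "is_two_cokernel L l a \<tau>"
    using a_cok ls by (simp add: two_cokernel_of_its_two_kernel_def)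
  note aD = two_cokernelD[OF this l a]

  \<comment> \<open>The isomorphism of \<open>f\<close> with \<open>n \<odot> a\<close> turns the
    nullity \<open>\<tau>\<close> of \<open>a \<odot> l\<close> into one of
    \<open>f \<odot> l\<close>, so \<open>l\<close> factors through \<open>k\<close> by
    \<open>t\<close>.\<close>
  define \<Phi> where "\<Phi> = (\<psi> \<lhd> e) \<bullet> \<phi>"
  have \<psi>e: "\<psi> \<lhd> e \<in> cells L (m \<odot> e) (n \<odot> a)"
    using rwhisker_cells[OF e m \<psi>] by (simp add: comp1_assoc[OF e q n] a_def)
  then have \<Phi>: "\<Phi> \<in> cells L f (n \<odot> a)"
    unfolding \<Phi>_def by (rule vcomp_cells[OF _ \<phi>])
  have "\<Phi> \<lhd> l \<in> cells L (f \<odot> l) (n \<odot> (a \<odot> l))"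
    using rwhisker_cells[OF l f \<Phi>] by (simp add: comp1_assoc[OF l a n])
  moreover have "n \<rhd> \<tau> \<in> cells L (n \<odot> (a \<odot> l)) (\<zero> M B)"
    using lwhisker_cells[OF n comp1_mor[OF l a] \<tau>] by (simp add: comp_zero[OF M n])
  ultimately have "(n \<rhd> \<tau>) \<bullet> (\<Phi> \<lhd> l) \<in> cells L (f \<odot> l) (\<zero> M B)"
    by (intro vcomp_cells)
  then obtain t \<zeta> where t: "t \<in> mor L M K" and \<zeta>: "\<zeta> \<in> cells L l (k \<odot> t)"
    and t_eq: "(n \<rhd> \<tau>) \<bullet> (\<Phi> \<lhd> l) = (\<kappa> \<lhd> t) \<bullet> (f \<rhd> \<zeta>)"
    using kerD(2)[rule_format, OF M l] by blast

  \<comment> \<open>Since \<open>l\<close> factors through \<open>k\<close>,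
    \<open>\<epsilon>\<close> induces a nullity of \<open>e \<odot> l\<close>; as \<open>a\<close>
    is a 2-cokernel of \<open>l\<close>, this yields \<open>r\<close> with \<open>e\<close>
    isomorphic to \<open>r \<odot> a\<close>.\<close>
  have "e \<rhd> \<zeta> \<in> cells L (e \<odot> l) ((e \<odot> k) \<odot> t)"
    using lwhisker_cells[OF e l \<zeta>] by (simp add: comp1_assoc[OF t k e])
  moreover have "\<epsilon> \<lhd> t \<in> cells L ((e \<odot> k) \<odot> t) (\<zero> M I)"
    using rwhisker_cells[OF t comp1_mor[OF k e] cokD(1)] by (simp add: zero_comp[OF ob(4) t])
  ultimately have "(\<epsilon> \<lhd> t) \<bullet> (e \<rhd> \<zeta>) \<in> cells L (e \<odot> l) (\<zero> M I)"
    by (intro vcomp_cells)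
  then obtain r \<xi> where r: "r \<in> mor L C I" and \<xi>: "\<xi> \<in> cells L e (r \<odot> a)"
    and r_eq: "(\<epsilon> \<lhd> t) \<bullet> (e \<rhd> \<zeta>) = (r \<rhd> \<tau>) \<bullet> (\<xi> \<lhd> l)"
    using aD(2)[rule_format, OF ob(4) e] by blast

  \<comment> \<open>Conversely \<open>a\<close> kills \<open>k\<close>, so \<open>k\<close> factors
    through \<open>l\<close> by \<open>w\<close>.\<close>
  have "q \<rhd> \<epsilon> \<in> cells L (a \<odot> k) (\<zero> K C)"
    using lwhisker_cells[OF q comp1_mor[OF k e] cokD(1)]
    by (simp add: comp_zero[OF ob(3) q] comp1_assoc[OF k e q] a_def)
  then obtain w \<omega> where w: "w \<in> mor L K M" and \<omega>: "\<omega> \<in> cells L k (l \<odot> w)"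
    and w_eq: "q \<rhd> \<epsilon> = (\<tau> \<lhd> w) \<bullet> (a \<rhd> \<omega>)"
    using two_kernelD(2)[OF ls a l, rule_format, OF ob(3) k] by blast

  \<comment> \<open>The two factorizations compose to an isomorphism of \<open>k\<close> with
    \<open>k \<odot> (t \<odot> w)\<close>. The calculation below shows it compatible with
    \<open>\<kappa>\<close>, so it lifts to \<open>\<upsilon>\<close>.\<close>
  define \<Lambda> where "\<Lambda> = (\<zeta> \<lhd> w) \<bullet> \<omega>"
  have tw: "t \<odot> w \<in> mor L K K" by (rule comp1_mor[OF w t])
  have K1: "id1 L K \<in> mor L K K" by (rule id1_mor[OF ob(3)])
  have \<Lambda>: "\<Lambda> \<in> cells L (k \<odot> id1 L K) (k \<odot> (t \<odot> w))"
    using vcomp_cells[OF rwhisker_cells[OF w l \<zeta>] \<omega>]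
    by (simp add: \<Lambda>_def comp1_id1[OF k] comp1_assoc[OF w t k])
  have ek: "e \<odot> k \<in> mor L K I" by (rule comp1_mor[OF k e])
  have "(\<kappa> \<lhd> (t \<odot> w)) \<bullet> (f \<rhd> \<Lambda>) = (n \<rhd> (q \<rhd> \<epsilon>)) \<bullet> (\<Phi> \<lhd> k)"
    unfolding \<Lambda>_def w_eq
    by (rule paste_factorizations[OF k l a f n t w kerD(1) \<tau> \<Phi> \<zeta> \<omega> t_eq])
  also have "\<dots> = ((n \<odot> q) \<rhd> \<epsilon>) \<bullet> ((\<psi> \<lhd> (e \<odot> k)) \<bullet> (\<phi> \<lhd> k))"
    by (simp add: \<Phi>_def rwhisker_vcomp[OF k f \<phi> \<psi>e] rwhisker_comp1[OF k e m \<psi>]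
        lwhisker_comp1[OF ek q n cokD(1)])
  also have "\<dots> = (((n \<odot> q) \<rhd> \<epsilon>) \<bullet> (\<psi> \<lhd> (e \<odot> k))) \<bullet> (\<phi> \<lhd> k)"
    using lwhisker_cells[OF comp1_mor[OF q n] ek cokD(1)] rwhisker_cells[OF ek m \<psi>]
      rwhisker_cells[OF k f \<phi>]
    by (simp add: vcomp_assoc comp1_assoc[OF k e m])
  \<comment> \<open>Exchanging \<open>\<psi>\<close> with \<open>\<epsilon>\<close> leaves
    \<open>\<psi>\<close> whiskered with zero, an identity; what remains is \<open>\<kappa>\<close>
    by \<open>\<kappa>_eq\<close>.\<close>
  also have "((n \<odot> q) \<rhd> \<epsilon>) \<bullet> (\<psi> \<lhd> (e \<odot> k)) = (\<psi> \<lhd> \<zero> K I) \<bullet> (m \<rhd> \<epsilon>)"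
    by (rule whisker_exchange[OF ek m cokD(1) \<psi>, symmetric])
  also have "\<dots> = m \<rhd> \<epsilon>"
    using lwhisker_cells[OF m ek cokD(1)]
    by (simp add: whisker_zero[OF m comp1_mor[OF q n] \<psi> ob(3)] comp_zero[OF ob(3) m] id2_vcomp)
  also have "(m \<rhd> \<epsilon>) \<bullet> (\<phi> \<lhd> k) = \<kappa> \<lhd> id1 L K"
    by (simp add: \<kappa>_eq[symmetric] rwhisker_id1[OF comp1_mor[OF k f] kerD(1)])
  finally have "\<exists>!\<upsilon>. \<upsilon> \<in> cells L (id1 L K) (t \<odot> w) \<and> k \<rhd> \<upsilon> = \<Lambda>"
    using kerD(3)[rule_format, OF ob(3) K1 tw \<Lambda>] by blast
  then obtain \<upsilon> where \<upsilon>: "\<upsilon> \<in> cells L (id1 L K) (t \<odot> w)" and k\<upsilon>: "k \<rhd> \<upsilon> = \<Lambda>" by blast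

  have I1: "id1 L I \<in> mor L I I" by (rule id1_mor[OF ob(4)])
  have rq: "r \<odot> q \<in> mor L I I" by (rule comp1_mor[OF q r])
  \<comment> \<open>The goal is compatibility of \<open>\<xi>\<close> with
    \<open>\<epsilon>\<close>. The same pasting, now for \<open>e\<close>, reduces it to
    \<open>e \<rhd> \<Lambda>\<close>, and \<open>\<upsilon>\<close> disappears on exchange with
    \<open>\<epsilon>\<close>.\<close>
  have "(r \<rhd> (q \<rhd> \<epsilon>)) \<bullet> (\<xi> \<lhd> k) = (\<epsilon> \<lhd> (t \<odot> w)) \<bullet> (e \<rhd> \<Lambda>)"
    unfolding \<Lambda>_def w_eq
    by (rule paste_factorizations[OF k l a e r t w cokD(1) \<tau> \<xi> \<zeta> \<omega> r_eq[symmetric], symmetric])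
  also have "\<dots> = (\<epsilon> \<lhd> (t \<odot> w)) \<bullet> ((e \<odot> k) \<rhd> \<upsilon>)"
    by (simp add: k\<upsilon>[symmetric] lwhisker_comp1[OF K1 k e \<upsilon>])
  also have "\<dots> = (\<zero> K I \<rhd> \<upsilon>) \<bullet> (\<epsilon> \<lhd> id1 L K)"
    by (rule whisker_exchange[OF K1 ek \<upsilon> cokD(1)])
  also have "\<dots> = id1 L I \<rhd> \<epsilon>"
    by (simp add: zero_whisker[OF K1 tw \<upsilon> ob(4)] rwhisker_id1[OF ek cokD(1)]
        id1_lwhisker[OF ek cokD(1)] id2_vcomp[OF cokD(1)])
  finally have "((r \<odot> q) \<rhd> \<epsilon>) \<bullet> (\<xi> \<lhd> k) = id1 L I \<rhd> \<epsilon>"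
    by (simp add: lwhisker_comp1[OF ek q r cokD(1)])
  moreover have "\<xi> \<in> cells L (id1 L I \<odot> e) ((r \<odot> q) \<odot> e)"
    using \<xi> by (simp add: id1_comp1[OF e] comp1_assoc[OF e q r] a_def)
  ultimately have "\<exists>!\<iota>. \<iota> \<in> cells L (id1 L I) (r \<odot> q) \<and> \<iota> \<lhd> e = \<xi>"
    using cokD(3)[rule_format, OF ob(4) I1 rq] by blast
  then obtain \<iota> where \<iota>: "\<iota> \<in> cells L (id1 L I) (r \<odot> q)" by blast

  have id: "id2 L (\<zero> X I) \<in> cells L (\<zero> X I) (\<zero> X I)" by (rule id2_cells[OF XI])
  \<comment> \<open>Exchange with \<open>\<iota>\<close>, trivial on zero morphisms, identifies
    \<open>\<mu>\<close> with \<open>(r \<odot> q) \<rhd> \<mu>\<close>, and \<open>q\<mu>\<close>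
    makes this an identity.\<close>
  have "\<mu> = (\<iota> \<lhd> \<zero> X I) \<bullet> (id1 L I \<rhd> \<mu>)"
    by (simp add: whisker_zero[OF I1 rq \<iota> X] id1_lwhisker[OF XI \<mu>] id2_vcomp[OF \<mu>])
  also have "\<dots> = ((r \<odot> q) \<rhd> \<mu>) \<bullet> (\<iota> \<lhd> \<zero> X I)"
    by (rule whisker_exchange[OF XI I1 \<mu> \<iota>])
  also have "\<dots> = id2 L (\<zero> X I)"
    by (simp add: whisker_zero[OF I1 rq \<iota> X] lwhisker_comp1[OF XI q r \<mu>] q\<mu>
        lwhisker_id2[OF r XC] comp_zero[OF X r] vcomp_id2[OF id])
  finally show ?thesis .
qed

text \<open>With \<open>e\<close> the 2-cokernel of the 2-kernel of \<open>f\<close>, only the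
  comparison \<open>m\<close> needs work: it is faithful by the two preceding reductions, hence a
  2-kernel by \<open>fai\<close>.\<close>

lemma ex_two_cokernel_two_kernel_factorization:
  assumes kers: "has_two_kernels L" and coks: "has_two_cokernels L"
    and fai: "\<And>m. faithful L m \<Longrightarrow> two_kernel L m"
    and cof: "\<And>e. cofaithful L e \<Longrightarrow> two_cokernel_of_its_two_kernel L e"
    and "f \<in> Mor L"
  shows "\<exists>e m. two_cokernel L e \<and> two_kernel L m \<and> trg L e = src L m \<and>
    src L e = src L f \<and> trg L m = trg L f \<and> iso_mor L f (m \<odot> e)"
proof -
  obtain A B where f: "f \<in> mor L A B" using \<open>f \<in> Mor L\<close> by (simp add: mor_def)
  obtain k \<kappa> where ker: "is_two_kernel L f k \<kappa>"
    using kers \<open>f \<in> Mor L\<close> unfolding has_two_kernels_def by blast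
  obtain K where k: "k \<in> mor L K A" and \<kappa>: "\<kappa> \<in> cells L (f \<odot> k) (\<zero> K B)"
    by (rule two_kernelE[OF ker f])
  obtain e \<epsilon> where cok: "is_two_cokernel L k e \<epsilon>"
    using coks k unfolding has_two_cokernels_def mor_def by blast
  obtain I where e: "e \<in> mor L A I" and \<epsilon>: "\<epsilon> \<in> cells L (e \<odot> k) (\<zero> K I)"
    by (rule two_cokernelE[OF cok k])
  obtain m \<phi> where m: "m \<in> mor L I B" and \<phi>: "\<phi> \<in> cells L f (m \<odot> e)"
    and eq: "\<kappa> = (m \<rhd> \<epsilon>) \<bullet> (\<phi> \<lhd> k)"
    using two_cokernelD(2)[OF cok k e] mor_Ob(2)[OF f] f \<kappa> by blast
  have "faithful L m"
    by (rule faithful_if_reflects_zero[OF m])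
      (rule reflects_zero_coimage_comparison[OF kers coks cof f k e ker cok m \<phi> eq])
  then have "two_kernel L m" by (rule fai)
  moreover have "two_cokernel L e"
    using cok unfolding two_cokernel_def by blast
  ultimately show ?thesis
    using f e m iso_morI[OF \<phi>] by (intro exI[of _ e] exI[of _ m]) (simp add: mor_def)
qed

end

section \<open>The equivalence of the two notions of exactness\<close>

theorem theorem4p19:
  fixes L :: "('o, 'm, 'c) lscg"
  assumes "locally_SCG_category L"
  shows "relatively_exact L \<longleftrightarrow>
    weakly_Puppe_two_exact L \<and>
    (\<forall>f. faithful L f \<longrightarrow> two_kernel L f) \<and>
    (\<forall>f. cofaithful L f \<longrightarrow> two_cokernel L f)"
proof -
  interpret locally_SCG_category L by (rule assms)
  show ?thesis
  proof
    assume rel: "relatively_exact L"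
    then have kers: "has_two_kernels L" and coks: "has_two_cokernels L"
      and fai: "\<And>f. faithful L f \<Longrightarrow> two_kernel_of_its_two_cokernel L f"
      and cof: "\<And>f. cofaithful L f \<Longrightarrow> two_cokernel_of_its_two_kernel L f"
      unfolding relatively_exact_def by blast+
    have fai_ker: "two_kernel L f" if "faithful L f" for f
    proof -
      have "f \<in> Mor L" using that by (simp add: faithful_def)
      \<comment> \<open>\<open>two_kernel_of_its_two_cokernel\<close> quantifies over all
        2-cokernels, so one must exist before it says that \<open>f\<close> is a 2-kernel.\<close>
      then obtain c \<beta> where "is_two_cokernel L f c \<beta>"
        using coks unfolding has_two_cokernels_def by blast
      with fai[OF that] have "is_two_kernel L c f \<beta>"
        by (simp add: two_kernel_of_its_two_cokernel_def)
      then show ?thesis unfolding two_kernel_def by blast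
    qed
    have cof_cok: "two_cokernel L f" if "cofaithful L f" for f
    proof -
      have "f \<in> Mor L" using that by (simp add: cofaithful_def)
      then obtain k \<beta> where "is_two_kernel L f k \<beta>"
        using kers unfolding has_two_kernels_def by blast
      with cof[OF that] have "is_two_cokernel L k f \<beta>"
        by (simp add: two_cokernel_of_its_two_kernel_def)
      then show ?thesis unfolding two_cokernel_def by blast
    qed
    have "\<forall>m. two_kernel L m \<longrightarrow> two_kernel_of_its_two_cokernel L m"
      using fai two_kernel_faithful unfolding two_kernel_def by blast
    moreover have "\<forall>e. two_cokernel L e \<longrightarrow> two_cokernel_of_its_two_kernel L e"
      using cof two_cokernel_cofaithful unfolding two_cokernel_def by blast
    ultimately show "weakly_Puppe_two_exact L \<and>
        (\<forall>f. faithful L f \<longrightarrow> two_kernel L f) \<and> (\<forall>f. cofaithful L f \<longrightarrow> two_cokernel L f)"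
      unfolding weakly_Puppe_two_exact_def
      using kers coks zero_ideal_weakly_closed fai_ker cof_cok
        ex_two_cokernel_two_kernel_factorization[OF kers coks fai_ker cof]
      by simp
  next
    assume "weakly_Puppe_two_exact L \<and>
      (\<forall>f. faithful L f \<longrightarrow> two_kernel L f) \<and> (\<forall>f. cofaithful L f \<longrightarrow> two_cokernel L f)"
    \<comment> \<open>A faithful morphism is a 2-kernel by hypothesis, hence a 2-kernel of its
      2-cokernel by Puppe exactness; dually for cofaithful ones.\<close>
    then show "relatively_exact L"
      unfolding weakly_Puppe_two_exact_def relatively_exact_def using assms by simp
  qed
qed

end
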